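(* For every integer $p \geq 0$, $$\frac{(p+1)(p+2)}{2}\,\zeta(p+4) = \sum_{m+n=p}\ \sum_{|\boldsymbol{\alpha}|=p+3} \zeta(\alpha_0,\alpha_1,\ldots,\alpha_m,\alpha_{m+1}+1)\left( \sum_{a+b+c=m} W_{\boldsymbol{\alpha}}(a,b,c) + \sum_{a+b=m} W_{\boldsymbol{\alpha}}(a,b,0) + \sum_{b+c=m} W_{\boldsymbol{\alpha}}(0,b,c) + W_{\boldsymbol{\alpha}}(0,m,0)\right),$$ where $m,n,a,b,c$ run over nonnegative integers, the sum over $\boldsymbol{\alpha}$ runs over all $(m+2)$-tuples $\boldsymbol{\alpha}=(\alpha_0,\alpha_1,\ldots,\alpha_{m+1})$ of positive integers with $\alpha_0+\cdots+\alpha_{m+1}=p+3$, and $$W_{\boldsymbol{\alpha}}(a,b,c) = 2^{\sigma(a+b+1)-\sigma(a)-(b+1)}\left(1-2^{1-\alpha_{a+b+1}}\right),\qquad \sigma(r)=\sum_{j=0}^{r}\alpha_j .$$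
   Context: For an $r$-tuple $(\alpha_1,\ldots,\alpha_r)$ of positive integers with $\alpha_r\ge 2$, the multiple zeta value is $\zeta(\alpha_1,\ldots,\alpha_r)=\sum_{1\le k_1<k_2<\cdots<k_r} k_1^{-\alpha_1}k_2^{-\alpha_2}\cdots k_r^{-\alpha_r}$ (the largest summation index carries the last exponent). In particular $\zeta(s)$ is the Riemann zeta value. *)

theory Defs
  imports "HOL-Analysis.Infinite_Sum"
begin

(* The list \<alpha>s = [\<alpha>_1, ..., \<alpha>_r] is indexed from 0, and the largest summation
   index, the last entry of ks, carries the last exponent. The sum converges when the
   entries of \<alpha>s are positive and the last is at least 2; otherwise infsum may return the
   junk value 0. *)
definition mzv :: "nat list \<Rightarrow> real" where
  "mzv \<alpha>s =
     (\<Sum>\<^sub>\<infinity>ks \<in> {ks :: nat list. length ks = length \<alpha>s \<and> sorted_wrt (<) ks \<and> (\<forall>k\<in>set ks. 1 \<le> k)}.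
        \<Prod>i<length \<alpha>s. 1 / real (ks ! i) ^ (\<alpha>s ! i))"

definition compositions :: "nat \<Rightarrow> nat \<Rightarrow> nat list set" where
  "compositions l w = {\<alpha>s. length \<alpha>s = l \<and> (\<forall>x\<in>set \<alpha>s. 1 \<le> x) \<and> sum_list \<alpha>s = w}"

definition psum :: "nat list \<Rightarrow> nat \<Rightarrow> nat" where
  "psum \<alpha>s r = (\<Sum>j\<le>r. \<alpha>s ! j)"

(* Only used when a + b + c + 2 = length \<alpha>s, so that all indices are in range. The exponents
   are taken in the integers because subtraction of natural numbers is truncated.
   W does not depend on c except through this constraint. *)
definition W :: "nat list \<Rightarrow> nat \<Rightarrow> nat \<Rightarrow> nat \<Rightarrow> real" where
  "W \<alpha>s a b c =
     2 powi (int (psum \<alpha>s (a + b + 1)) - int (psum \<alpha>s a) - (int b + 1))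
       * (1 - 2 powi (1 - int (\<alpha>s ! (a + b + 1))))"

end

theory Submission
  imports Defs "HOL-Analysis.Analysis" "HOL-Real_Asymp.Real_Asymp"
begin

text \<open>
  The identities for all \<open>p\<close> are proved together: multiply by \<open>u\<^sup>p\<close> with \<open>0 < u < 1 / 2\<close>, sum over
  \<open>p\<close>, and compare coefficients at the end (\<open>powser_unique_right\<close>). All terms are nonnegative, so
  every exchange of summations is legitimate (\<open>tonelli_sums\<close>).

  The left-hand side becomes \<open>\<Sum>\<^sub>k 1 / (k (k - u)\<^sup>3)\<close> (\<open>zeta_gf\<close>).

  On the right, \<open>W\<close> is a product over the positions of the exponent tuple: the \<open>a + 1\<close> first
  entries contribute 1, the next \<open>b\<close> entries \<open>2 ^ (x - 1)\<close> each, the entry after them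
  \<open>2 ^ (x - 1) - 1\<close>, and the last \<open>c\<close> entries 1. The four sums over \<open>a, b, c\<close> amount to counting
  \<open>a = 0\<close> and \<open>c = 0\<close> twice (\<open>W_sums_eq\<close>). Summing over the exponents turns an entry attached to the
  index \<open>k\<close> into one of the local factors \<open>u / (k - u)\<close>, \<open>u / (k - 2 u)\<close>,
  \<open>u\<^sup>2 / ((k - u) (k - 2 u))\<close>. The sum over all indices below the largest one then satisfies a
  first-order recursion for each block, and these recursions have closed solutions in terms of
  \<open>e\<^sub>k = \<Prod>\<^sub>j\<^sub>\<le>\<^sub>k j / (j - u)\<close>, the harmonic numbers \<open>H\<^sub>k\<close>, and the convolution
  \<open>x\<^sub>k = \<Sum> e\<^sub>i / (i (j - u))\<close> over \<open>i + j = k\<close> (\<open>top_slice_word_weight_sums\<close>). The part with largest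
  index \<open>k\<close> turns out to be \<open>\<rho>\<^sub>k\<close> with (\<open>slice_gf_eq\<close>)

  \<open>u \<rho>\<^sub>k = x\<^sub>k / (k - u) - e\<^sub>k H\<^sub>k\<^sub>-\<^sub>1 / k\<^sup>2 - (e\<^sub>k / k\<^sup>2 - 1 / (k (k - u))) / u\<close>.

  It remains to know \<open>\<Sum> e\<^sub>k / k\<^sup>2 = \<Sum> 1 / (k - u)\<^sup>2\<close>, \<open>\<Sum> e\<^sub>k H\<^sub>k\<^sub>-\<^sub>1 / k\<^sup>2 = \<Sum> 1 / (k - u)\<^sup>3\<close> and
  \<open>\<Sum> x\<^sub>k / (k - u) = 2 \<Sum> 1 / (k - u)\<^sup>3\<close>; with these, \<open>\<Sum> \<rho>\<^sub>k = \<Sum> 1 / (k (k - u)\<^sup>3)\<close> is partial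
  fractions (\<open>sums_slice_gf\<close>). The three evaluations use a connected sum: \<open>e\<^sub>K\<close> is the value at
  \<open>n = 0\<close> of the connector \<open>\<Prod>\<^sub>i\<^sub>\<le>\<^sub>K i / (i + n - u)\<close>, which telescopes in \<open>n\<close> as well as in \<open>K\<close>
  (\<open>connector_diff_left\<close>, \<open>connector_diff_right\<close>), so that the index \<open>K\<close> can be traded for \<open>n\<close>.
\<close>

section \<open>Nonnegative double series and power series\<close>

text \<open>
  Tonelli's theorem for double series of nonnegative reals, phrased so that convergence of the
  columns is a conclusion: convergence of the multiple zeta values on the right-hand side of the
  theorem is obtained from it.
\<close>
lemma tonelli_sums:
  fixes f :: "nat \<Rightarrow> nat \<Rightarrow> real"
  assumes nonneg: "\<And>i j. 0 \<le> f i j"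
    and rows: "\<And>i. f i sums g i" and total: "g sums s"
  shows "summable (\<lambda>i. f i j)" and "(\<lambda>j. \<Sum>i. f i j) sums s"
proof -
  have g_nonneg: "0 \<le> g i" for i
    using rows[of i] nonneg by (metis sums_unique sums_summable suminf_nonneg)
  have rows': "((\<lambda>j. case (i, j) of (i, j) \<Rightarrow> f i j) has_sum g i) UNIV" for i
    using sums_nonneg_imp_has_sum[OF rows nonneg] by simp
  have total': "(g has_sum s) UNIV"
    by (rule sums_nonneg_imp_has_sum[OF total g_nonneg])
  have summ: "(\<lambda>(i, j). f i j) summable_on UNIV \<times> UNIV"
    by (rule summable_on_SigmaI[where f = "\<lambda>(i, j). f i j", OF rows']) (use total' nonneg in \<open>auto simp: has_sum_imp_summable\<close>)
  have "((\<lambda>(i, j). f i j) has_sum s) (UNIV \<times> UNIV)"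
    by (rule has_sum_SigmaI[where f = "\<lambda>(i, j). f i j", OF rows' total' summ])
  then have swapped: "((\<lambda>(j, i). f i j) has_sum s) (UNIV \<times> UNIV)"
    by (subst has_sum_swap) (simp add: case_prod_unfold)
  have col: "(\<lambda>i. f i j) summable_on UNIV" for j
    using summable_on_SigmaD1[of "\<lambda>j i. f i j" UNIV "\<lambda>_. UNIV" j] swapped
    by (simp add: has_sum_imp_summable)
  then show "summable (\<lambda>i. f i j)"
    using summable_on_imp_summable by blast
  have col': "((\<lambda>i. case (j, i) of (j, i) \<Rightarrow> f i j) has_sum (\<Sum>i. f i j)) UNIV" for j
    using has_sum_infsum[OF col[of j]] has_sum_imp_sums[OF has_sum_infsum[OF col[of j]]]
    by (simp add: sums_iff)
  have "((\<lambda>j. \<Sum>i. f i j) has_sum s) UNIV"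
    by (rule has_sum_SigmaD[where f = "\<lambda>(j, i). f i j", OF swapped col'])
  then show "(\<lambda>j. \<Sum>i. f i j) sums s"
    by (rule has_sum_imp_sums)
qed

lemma sums_swap:
  fixes f :: "nat \<Rightarrow> nat \<Rightarrow> real"
  assumes "\<And>i j. 0 \<le> f i j" "\<And>i. f i sums g i" "\<And>j. (\<lambda>i. f i j) sums h j" "h sums s"
  shows "g sums s"
proof -
  have "(\<lambda>i. \<Sum>j. f i j) sums s"
    by (rule tonelli_sums(2)[of "\<lambda>j i. f i j"]) (use assms in auto)
  then show ?thesis
    using assms(2) by (simp add: sums_iff)
qed

text \<open>
  All convergence arguments use positivity, so power series are compared on a right neighbourhood
  of 0 only. The lowest coefficient in which they differ would be the limit at 0 of a shifted
  series that vanishes on that neighbourhood.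
\<close>
lemma powser_unique_right:
  fixes a b :: "nat \<Rightarrow> real"
  assumes r: "0 < r"
    and a: "\<And>u. 0 < u \<Longrightarrow> u < r \<Longrightarrow> (\<lambda>p. a p * u ^ p) sums f u"
    and b: "\<And>u. 0 < u \<Longrightarrow> u < r \<Longrightarrow> (\<lambda>p. b p * u ^ p) sums f u"
  shows "a = b"
proof -
  define d where "d p = a p - b p" for p
  have d: "(\<lambda>p. d p * u ^ p) sums 0" if "0 < u" "u < r" for u
    using sums_diff[OF a[OF that] b[OF that]] by (simp add: d_def left_diff_distrib)
  have "d n = 0" for n
  proof (induction n rule: less_induct)
    case (less n)
    have shifted: "(\<lambda>p. d (p + n) * u ^ p) sums 0" if u: "0 < u" "u < r" for u
    proof -
      have "(\<lambda>p. d (p + n) * u ^ (p + n)) sums 0"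
        using d[OF u] less by (subst sums_zero_iff_shift) auto
      from sums_divide[OF this, of "u ^ n"] show ?thesis
        using u by (simp add: power_add)
    qed
    define g where "g x = (\<Sum>p. d (p + n) * x ^ p)" for x
    have "(\<lambda>p. d (p + n) * x ^ p) sums g x" if "norm x < r / 2" for x
      unfolding g_def
      by (intro summable_sums powser_inside[OF sums_summable[OF shifted[of "r / 2"]]])
        (use r that in auto)
    then have "(g \<longlongrightarrow> d (0 + n)) (at 0)"
      by (intro powser_limit_0[of "r / 2"]) (use r in auto)
    then have lim: "(g \<longlongrightarrow> d n) (at_right 0)"
      by (simp add: filterlim_at_split)
    have "eventually (\<lambda>x. 0 = g x) (at_right 0)"
      using eventually_at_right_less[of 0] eventually_at_right_real[OF r]
      by eventually_elim (use shifted in \<open>auto simp: g_def sums_iff\<close>)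
    then have "(g \<longlongrightarrow> 0) (at_right 0)"
      by (rule Lim_transform_eventually[OF tendsto_const])
    from tendsto_unique[OF _ lim this] show ?case
      by simp
  qed
  then show ?thesis
    by (auto simp: d_def)
qed

lemma triangular_gf:
  fixes z :: real
  assumes z: "0 \<le> z" "z < 1"
  shows "(\<lambda>p. (real p + 1) * (real p + 2) / 2 * z ^ p) sums (1 / (1 - z) ^ 3)"
proof -
  have a: "(\<lambda>n. real (Suc n) * z ^ n) sums (1 / (1 - z)\<^sup>2)"
    using geometric_deriv_sums[of z] z by simp
  have b: "(\<lambda>n. z ^ n) sums (1 / (1 - z))"
    using geometric_sums[of z] z by simp
  have "(\<lambda>k. \<Sum>i\<le>k. real (Suc i) * z ^ i * z ^ (k - i)) sums (1 / (1 - z)\<^sup>2 * (1 / (1 - z)))"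
    unfolding sums_unique[OF a] sums_unique[OF b]
    by (rule Cauchy_product_sums) (use sums_summable[OF a] sums_summable[OF b] z in \<open>simp_all add: abs_mult\<close>)
  moreover have "(\<Sum>i\<le>k. real (Suc i) * z ^ i * z ^ (k - i))
      = (real k + 1) * (real k + 2) / 2 * z ^ k" for k
  proof -
    have "(\<Sum>i\<le>k. real (Suc i) * z ^ i * z ^ (k - i)) = (\<Sum>i\<le>k. real (Suc i) * z ^ k)"
      by (rule sum.cong) (simp_all add: mult.assoc flip: power_add)
    also have "\<dots> = (\<Sum>i\<le>k. real (Suc i)) * z ^ k"
      by (simp only: sum_distrib_right)
    also have "(\<Sum>i\<le>k. real (Suc i)) = (real k + 1) * (real k + 2) / 2"
      by (induction k) (simp_all add: field_simps)
    finally show ?thesis .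
  qed
  moreover have "1 / (1 - z)\<^sup>2 * (1 / (1 - z)) = 1 / (1 - z) ^ 3"
    by (simp add: power2_eq_square power3_eq_cube)
  ultimately show ?thesis by (simp only:)
qed

section \<open>Connector series\<close>

text \<open>
  Here and below an index \<open>k \<ge> 1\<close> of the informal formulas appears as \<open>real n + 1\<close> with \<open>n :: nat\<close>.
  The value \<open>connector u n K\<close> is the Beta-like quotient
  \<open>K! \<Gamma>(n + 1 - u) / \<Gamma>(K + n + 1 - u)\<close>: it links an index \<open>K\<close> of the series to be evaluated with
  an index \<open>n\<close> of the target series, and at \<open>n = 0\<close> it is \<open>e\<^sub>K = \<Prod>\<^sub>j\<^sub>\<le>\<^sub>K j / (j - u)\<close>.
\<close>
definition connector :: "real \<Rightarrow> nat \<Rightarrow> nat \<Rightarrow> real" where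
  "connector u n K = (\<Prod>i<K. (real i + 1) / (real i + 1 + real n - u))"

definition shifted_harm :: "real \<Rightarrow> nat \<Rightarrow> nat \<Rightarrow> real" where
  "shifted_harm u n K = (\<Sum>i<K. 1 / (real i + 1 + real n - u))"

abbreviation harmonic :: "nat \<Rightarrow> real" where
  "harmonic K \<equiv> shifted_harm 0 0 K"

lemma connector_0 [simp]: "connector u n 0 = 1"
  by (simp add: connector_def)

lemma connector_Suc:
  "connector u n (Suc K) = connector u n K * (real K + 1) / (real K + 1 + real n - u)"
  by (simp add: connector_def)

lemma shifted_harm_0 [simp]: "shifted_harm v n 0 = 0"
  by (simp add: shifted_harm_def)

lemma shifted_harm_Suc:
  "shifted_harm v n (Suc K) = shifted_harm v n K + 1 / (real K + 1 + real n - v)"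
  by (simp add: shifted_harm_def)

lemma shifted_harm_nonneg: "v < 1 \<Longrightarrow> 0 \<le> shifted_harm v n K"
  unfolding shifted_harm_def by (intro sum_nonneg) auto

lemma shifted_harm_shift:
  "shifted_harm u n K
     = shifted_harm u (Suc n) K + 1 / (real n + 1 - u) - 1 / (real K + real n + 1 - u)"
  by (induction K) (simp_all add: shifted_harm_Suc algebra_simps)

lemma harmonic_le_ln: "harmonic K \<le> ln (real K + 1) + 1"
proof -
  have "harmonic (Suc K) \<le> ln (real K + 1) + 1" for K
  proof (induction K)
    case (Suc K)
    have "ln ((real K + 1) / (real K + 2)) \<le> (real K + 1) / (real K + 2) - 1"
      by (intro ln_le_minus_one) auto
    also have "\<dots> = - (1 / (real K + 2))"
      by (simp add: field_simps)
    finally have "1 / (real K + 2) \<le> ln (real K + 2) - ln (real K + 1)"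
      by (simp add: ln_div)
    then show ?case
      using Suc by (simp add: shifted_harm_Suc[of _ _ "Suc K"] add_ac)
  qed (simp add: shifted_harm_Suc)
  moreover have "harmonic K \<le> harmonic (Suc K)"
    by (simp add: shifted_harm_Suc)
  ultimately show ?thesis
    by (meson order_trans)
qed

context
  fixes u :: real
  assumes u: "0 < u" "u < 1 / 2"
begin

lemma connector_pos: "0 < connector u n K"
  using u unfolding connector_def by (intro prod_pos) auto

lemma shifted_harm_le_harmonic: "shifted_harm u (Suc n) K \<le> harmonic K"
  unfolding shifted_harm_def by (intro sum_mono divide_left_mono mult_pos_pos) (use u in auto)

lemma connector_shift:
  "connector u n K = connector u (Suc n) K * (real K + real n + 1 - u) / (real n + 1 - u)"
proof (induction K)
  case 0
  then show ?case using u by simp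
next
  case (Suc K)
  define A where "A = real K + 1 + real n - u"
  define B where "B = real n + 1 - u"
  have pos: "A > 0" "B > 0" using u by (simp_all add: A_def B_def)
  have "connector u n (Suc K) = connector u n K * (real K + 1) / A"
    by (simp add: connector_Suc A_def)
  also have "connector u n K = connector u (Suc n) K * A / B"
    unfolding Suc by (simp add: A_def B_def algebra_simps)
  also have "connector u (Suc n) K * A / B * (real K + 1) / A
      = connector u (Suc n) K * (real K + 1) / (A + 1) * (A + 1) / B"
    using pos by simp
  also have "\<dots> = connector u (Suc n) (Suc K) * (real (Suc K) + real n + 1 - u) / (real n + 1 - u)"
    by (simp add: connector_Suc A_def B_def algebra_simps)
  finally show ?case .
qed

text \<open>
  The differences of the connector in \<open>n\<close> and in \<open>K\<close> are both the connector times a simple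
  rational factor, \<open>K / (n + 1 - u)\<close> and (at \<open>K - 1\<close>) its reciprocal. A series telescoping in one
  index therefore becomes, after exchanging the summations, one telescoping in the other.
\<close>
lemma connector_diff_left:
  "connector u n K - connector u (Suc n) K = connector u (Suc n) K * real K / (real n + 1 - u)"
  using u by (simp add: connector_shift[of n] field_simps)

lemma connector_diff_right:
  "connector u (Suc n) K - connector u (Suc n) (Suc K)
     = connector u (Suc n) (Suc K) * (real n + 1 - u) / (real K + 1)"
proof -
  define A where "A = real K + 1 + real (Suc n) - u"
  have pos: "A > 0" using u by (simp add: A_def)
  have d: "real n + 1 - u = A - (real K + 1)"
    by (simp add: A_def)
  have "c - c * k / A = c * k / A * (A - k) / k" if "k > 0" for c k
    using pos that by (simp add: field_simps)
  from this[of "real K + 1"] show ?thesis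
    unfolding d connector_Suc A_def[symmetric] by simp
qed

lemma connector_tendsto_left: "(\<lambda>n. connector u n (Suc K)) \<longlonglongrightarrow> 0"
proof (induction K)
  case 0
  have "connector u n (Suc 0) = 1 / (1 + real n - u)" for n
    by (simp add: connector_def)
  then show ?case by simp real_asymp
next
  case (Suc K)
  have "(\<lambda>n. connector u n (Suc K) * ((real K + 2) / (real K + 2 + real n - u))) \<longlonglongrightarrow> 0 * 0"
    by (rule tendsto_mult[OF Suc]) real_asymp
  then show ?case
    by (simp add: connector_Suc[of _ _ "Suc K"] add_ac)
qed

text \<open>
  Any decay rate that beats the logarithmic growth of the harmonic numbers suffices below; the
  bound \<open>u < 1 / 2\<close> makes the square root available.
\<close>
lemma connector_le: "connector u (Suc n) K \<le> 1 / sqrt (real K + 1)"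
proof (induction K)
  case (Suc K)
  let ?k = "real K"
  have "(?k + 1) * sqrt (?k + 2) = sqrt ((?k + 1) * ((?k + 1) * (?k + 2)))"
    by (simp add: real_sqrt_mult)
  also have "\<dots> \<le> sqrt ((?k + 1) * (?k + 3 / 2)\<^sup>2)"
    by (intro real_sqrt_le_mono mult_left_mono) (simp_all add: power2_eq_square algebra_simps)
  also have "\<dots> = sqrt (?k + 1) * (?k + 3 / 2)"
    by (simp add: real_sqrt_mult)
  finally have key: "(?k + 1) / (?k + 3 / 2) \<le> sqrt (?k + 1) / sqrt (?k + 2)"
    by (simp add: pos_divide_le_eq pos_le_divide_eq)
  have "connector u (Suc n) (Suc K) = connector u (Suc n) K * ((?k + 1) / (?k + 2 + real n - u))"
    by (simp add: connector_Suc add_ac)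
  also have "\<dots> \<le> 1 / sqrt (?k + 1) * ((?k + 1) / (?k + 3 / 2))"
    using u by (intro mult_mono Suc divide_left_mono) (auto intro!: mult_pos_pos)
  also have "\<dots> \<le> 1 / sqrt (?k + 1) * (sqrt (?k + 1) / sqrt (?k + 2))"
    by (intro mult_left_mono key) simp
  also have "\<dots> = 1 / sqrt (real (Suc K) + 1)"
    by simp
  finally show ?case .
qed simp

lemma connector_harmonic_tendsto: "(\<lambda>K. connector u (Suc n) K * harmonic K) \<longlonglongrightarrow> 0"
proof (rule tendsto_sandwich[OF _ _ tendsto_const])
  show "eventually (\<lambda>K. 0 \<le> connector u (Suc n) K * harmonic K) sequentially"
    by (intro always_eventually allI mult_nonneg_nonneg less_imp_le[OF connector_pos]
        shifted_harm_nonneg) simp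
  show "eventually (\<lambda>K. connector u (Suc n) K * harmonic K \<le> 1 / sqrt (real K + 1) * (ln (real K + 1) + 1))
      sequentially"
    by (intro always_eventually allI mult_mono connector_le harmonic_le_ln shifted_harm_nonneg) auto
  show "(\<lambda>K. 1 / sqrt (real K + 1) * (ln (real K + 1) + 1)) \<longlonglongrightarrow> 0"
    by real_asymp
qed

lemma connector_tendsto_right: "(\<lambda>K. connector u (Suc n) K) \<longlonglongrightarrow> 0"
proof (rule tendsto_sandwich[OF _ _ tendsto_const])
  show "(\<lambda>K. 1 / sqrt (real K + 1)) \<longlonglongrightarrow> 0"
    by real_asymp
qed (use connector_le less_imp_le[OF connector_pos] in auto)

lemma sums_connector:
  "(\<lambda>i. connector u (Suc n) (Suc i) / (real i + 1)) sums (1 / (real n + 1 - u))"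
proof -
  have "(\<lambda>i. (connector u (Suc n) i - connector u (Suc n) (Suc i)) / (real n + 1 - u)) sums
      ((connector u (Suc n) 0 - 0) / (real n + 1 - u))"
    by (intro sums_divide telescope_sums' connector_tendsto_right)
  then show ?thesis
    using u by (simp add: connector_diff_right)
qed

lemma sums_connector_harmonic:
  "(\<lambda>i. connector u (Suc n) (Suc i) * harmonic i / (real i + 1)) sums (1 / (real n + 1 - u)\<^sup>2)"
proof -
  define d where "d = real n + 1 - u"
  have d: "d > 0" using u by (simp add: d_def)
  \<comment> \<open>summation by parts against the harmonic numbers; the second summand of \<open>g\<close> sums the remainder\<close>
  define g where "g i = connector u (Suc n) i * harmonic i + connector u (Suc n) i / d" for i
  have "(\<lambda>i. (g i - g (Suc i)) / d) sums ((g 0 - (0 + 0 / d)) / d)"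
    unfolding g_def
    by (intro sums_divide telescope_sums' tendsto_add connector_tendsto_right connector_harmonic_tendsto tendsto_intros)
      (use d in auto)
  moreover have "(g i - g (Suc i)) / d = connector u (Suc n) (Suc i) * harmonic i / (real i + 1)" for i
  proof -
    have c: "connector u (Suc n) i = connector u (Suc n) (Suc i) * (1 + d / (real i + 1))"
      using connector_diff_right[of n i] by (simp add: d_def algebra_simps)
    have "(a * (1 + d / x) * h + a * (1 + d / x) / d - (a * (h + 1 / x) + a / d)) / d = a * h / x"
      if "x > 0" for a x h
      using that d by (simp add: add_divide_distrib algebra_simps)
    from this[of "real i + 1"] show ?thesis
      unfolding g_def c by (simp add: shifted_harm_Suc)
  qed
  ultimately show ?thesis
    using d by (simp add: g_def d_def power2_eq_square)
qed

lemma sums_connector_shifted_harm: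
  "(\<lambda>i. connector u (Suc n) (Suc i) * shifted_harm u (Suc n) (Suc i) / (real i + 1))
     sums (1 / (real n + 1 - u)\<^sup>2)"
proof -
  define d where "d = real n + 1 - u"
  have d: "d > 0" using u by (simp add: d_def)
  define S where "S = shifted_harm u (Suc n)"
  define g where "g i = connector u (Suc n) i * S i + connector u (Suc n) i / d" for i
  have lim: "(\<lambda>i. connector u (Suc n) i * S i) \<longlonglongrightarrow> 0"
  proof (rule tendsto_sandwich[OF _ _ tendsto_const connector_harmonic_tendsto])
    show "eventually (\<lambda>i. 0 \<le> connector u (Suc n) i * S i) sequentially"
      using u by (auto simp: S_def intro!: always_eventually mult_nonneg_nonneg
          less_imp_le[OF connector_pos] shifted_harm_nonneg)
    show "eventually (\<lambda>i. connector u (Suc n) i * S i \<le> connector u (Suc n) i * harmonic i) sequentially"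
      unfolding S_def
      by (intro always_eventually allI mult_left_mono shifted_harm_le_harmonic less_imp_le[OF connector_pos])
  qed
  have "(\<lambda>i. (g i - g (Suc i)) / d) sums ((g 0 - (0 + 0 / d)) / d)"
    unfolding g_def
    by (intro sums_divide telescope_sums' tendsto_add connector_tendsto_right lim tendsto_intros)
      (use d in auto)
  moreover have "(g i - g (Suc i)) / d = connector u (Suc n) (Suc i) * S (Suc i) / (real i + 1)" for i
  proof -
    have c: "connector u (Suc n) i = connector u (Suc n) (Suc i) * ((real i + 1 + d) / (real i + 1))"
      using connector_diff_right[of n i] by (simp add: d_def field_simps)
    have s: "S i = S (Suc i) - 1 / (real i + 1 + d)"
      by (simp add: S_def shifted_harm_Suc d_def algebra_simps)
    have "(a * ((x + d) / x) * (y - 1 / (x + d)) + a * ((x + d) / x) / d - (a * y + a / d)) / d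
        = a * y / x" if "x > 0" for a x y
    proof -
      have "a * ((x + d) / x) * (1 / (x + d)) = a / x" using that d by simp
      then have EQ: "a * ((x + d) / x) * (y - 1 / (x + d)) = a * ((x + d) / x) * y - a / x"
        by (simp only: right_diff_distrib)
      show ?thesis
        unfolding EQ using that d by (simp add: field_simps)
    qed
    from this[of "real i + 1"] show ?thesis
      unfolding g_def c s by simp
  qed
  ultimately show ?thesis
    using d by (simp add: g_def S_def d_def power2_eq_square)
qed

lemma summable_inverse_pow:
  assumes "1 < m"
  shows "summable (\<lambda>n. 1 / (real n + 1 - u) ^ m)"
  using Polygamma_converges'[of "1 - u" m] assms u by (simp add: inverse_eq_divide algebra_simps)

text \<open>
  This and the next two evaluations have the same proof: write the summand as a telescoping
  series in \<open>n\<close>, exchange the summations, and sum over the other index by the telescoping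
  evaluations above. The third one is the derivative of the first with respect to \<open>u\<close>, since
  \<open>shifted_harm u n K\<close> is the logarithmic derivative of \<open>connector u n K\<close>.
\<close>
lemma sums_connector_zero:
  "(\<lambda>i. connector u 0 (Suc i) / (real i + 1)\<^sup>2) sums (\<Sum>n. 1 / (real n + 1 - u)\<^sup>2)"
proof (rule sums_swap)
  let ?f = "\<lambda>i n. connector u (Suc n) (Suc i) / ((real i + 1) * (real n + 1 - u))"
  show "0 \<le> ?f i n" for i n
    using u connector_pos[of "Suc n" "Suc i"] by simp
  have "(\<lambda>n. (connector u n (Suc i) - connector u (Suc n) (Suc i)) / (real i + 1)\<^sup>2) sums
      ((connector u 0 (Suc i) - 0) / (real i + 1)\<^sup>2)" for i
    by (intro sums_divide telescope_sums' connector_tendsto_left)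
  moreover have "(connector u n (Suc i) - connector u (Suc n) (Suc i)) / (real i + 1)\<^sup>2 = ?f i n" for i n
    by (simp add: connector_diff_left power2_eq_square add_ac)
  ultimately show "?f i sums (connector u 0 (Suc i) / (real i + 1)\<^sup>2)" for i
    by simp
  show "(\<lambda>i. ?f i n) sums (1 / (real n + 1 - u)\<^sup>2)" for n
    using sums_divide[OF sums_connector, of n "real n + 1 - u"] by (simp add: power2_eq_square)
  show "(\<lambda>n. 1 / (real n + 1 - u)\<^sup>2) sums (\<Sum>n. 1 / (real n + 1 - u)\<^sup>2)"
    by (intro summable_sums summable_inverse_pow) simp
qed

lemma sums_connector_zero_harmonic:
  "(\<lambda>i. connector u 0 (Suc i) / (real i + 1)\<^sup>2 * harmonic i) sums (\<Sum>n. 1 / (real n + 1 - u) ^ 3)"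
proof (rule sums_swap)
  let ?f = "\<lambda>i n. connector u (Suc n) (Suc i) / ((real i + 1) * (real n + 1 - u)) * harmonic i"
  show "0 \<le> ?f i n" for i n
    using u connector_pos[of "Suc n" "Suc i"] shifted_harm_nonneg[of 0 0 i] by simp
  have "(\<lambda>n. (connector u n (Suc i) - connector u (Suc n) (Suc i)) / (real i + 1)\<^sup>2 * harmonic i) sums
      ((connector u 0 (Suc i) - 0) / (real i + 1)\<^sup>2 * harmonic i)" for i
    by (intro sums_divide sums_mult2 telescope_sums' connector_tendsto_left)
  moreover have "(connector u n (Suc i) - connector u (Suc n) (Suc i)) / (real i + 1)\<^sup>2 * harmonic i = ?f i n" for i n
    by (simp add: connector_diff_left power2_eq_square add_ac)
  ultimately show "?f i sums (connector u 0 (Suc i) / (real i + 1)\<^sup>2 * harmonic i)" for i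
    by simp
  show "(\<lambda>i. ?f i n) sums (1 / (real n + 1 - u) ^ 3)" for n
    using sums_divide[OF sums_connector_harmonic, of n "real n + 1 - u"]
    by (simp add: power2_eq_square power3_eq_cube mult_ac)
  show "(\<lambda>n. 1 / (real n + 1 - u) ^ 3) sums (\<Sum>n. 1 / (real n + 1 - u) ^ 3)"
    by (intro summable_sums summable_inverse_pow) simp
qed

lemma sums_connector_zero_shifted_harm:
  "(\<lambda>i. connector u 0 (Suc i) / (real i + 1)\<^sup>2 * shifted_harm u 0 (Suc i))
     sums (2 * (\<Sum>n. 1 / (real n + 1 - u) ^ 3))"
proof (rule sums_swap)
  let ?f = "\<lambda>i n. connector u (Suc n) (Suc i) * shifted_harm u (Suc n) (Suc i) / (real i + 1) / (real n + 1 - u)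
    + connector u (Suc n) (Suc i) / (real i + 1) / (real n + 1 - u)\<^sup>2"
  show "0 \<le> ?f i n" for i n
    using u connector_pos[of "Suc n" "Suc i"] shifted_harm_nonneg[of u "Suc n" "Suc i"] by simp
  have lim: "(\<lambda>n. connector u n (Suc i) * shifted_harm u n (Suc i)) \<longlonglongrightarrow> 0" for i
  proof -
    have "(\<lambda>n. connector u n (Suc i) * (\<Sum>j<Suc i. 1 / (real j + 1 + real n - u))) \<longlonglongrightarrow>
        0 * (\<Sum>j<Suc i. 0)"
    proof (intro tendsto_mult tendsto_sum connector_tendsto_left)
      show "(\<lambda>n. 1 / (real j + 1 + real n - u)) \<longlonglongrightarrow> 0" for j
        by real_asymp
    qed
    then show ?thesis by (simp add: shifted_harm_def)
  qed
  have "(\<lambda>n. (connector u n (Suc i) * shifted_harm u n (Suc i)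
        - connector u (Suc n) (Suc i) * shifted_harm u (Suc n) (Suc i)) / (real i + 1)\<^sup>2) sums
      ((connector u 0 (Suc i) * shifted_harm u 0 (Suc i) - 0) / (real i + 1)\<^sup>2)" for i
    by (intro sums_divide telescope_sums' lim)
  moreover have "(connector u n (Suc i) * shifted_harm u n (Suc i)
        - connector u (Suc n) (Suc i) * shifted_harm u (Suc n) (Suc i)) / (real i + 1)\<^sup>2 = ?f i n" for i n
  proof -
    define d where "d = real n + 1 - u"
    define x where "x = real i + 1"
    have pos: "d > 0" "x > 0" using u by (simp_all add: d_def x_def)
    have c: "connector u n (Suc i) = connector u (Suc n) (Suc i) * (x + d) / d"
      by (subst connector_shift) (simp add: d_def x_def add_ac)
    have s: "shifted_harm u n (Suc i) = shifted_harm u (Suc n) (Suc i) + 1 / d - 1 / (x + d)"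
      by (subst shifted_harm_shift) (simp add: d_def x_def add_ac algebra_simps)
    have "(a * (x + d) / d * (y + 1 / d - 1 / (x + d)) - a * y) / x\<^sup>2 = a * y / x / d + a / x / d\<^sup>2"
      for a y
    proof -
      have EQ: "a * (x + d) / d * (y + 1 / d - 1 / (x + d)) - a * y = a * x * y / d + a * x / d\<^sup>2"
      proof -
        have "a * (x + d) / d * (p - q) = a * (x + d) / d * p - a / d * ((x + d) * q)" for p q
          by (simp add: right_diff_distrib)
        from this[of "y + 1 / d" "1 / (x + d)"]
        have "a * (x + d) / d * (y + 1 / d - 1 / (x + d))
            = a * (x + d) / d * (y + 1 / d) - a / d * ((x + d) * (1 / (x + d)))" .
        also have "(x + d) * (1 / (x + d)) = 1" using pos by simp
        finally have EQ: "a * (x + d) / d * (y + 1 / d - 1 / (x + d))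
            = a * (x + d) / d * (y + 1 / d) - a / d * 1" .
        show ?thesis
          unfolding EQ using pos by (simp add: field_simps power2_eq_square)
      qed
      show ?thesis
        unfolding EQ using pos by (simp add: field_simps power2_eq_square)
    qed
    then show ?thesis
      unfolding c s by (simp add: d_def x_def)
  qed
  ultimately show "?f i sums (connector u 0 (Suc i) / (real i + 1)\<^sup>2 * shifted_harm u 0 (Suc i))" for i
    by simp
  show "(\<lambda>i. ?f i n) sums (2 * (1 / (real n + 1 - u) ^ 3))" for n
  proof -
    have "(\<lambda>i. ?f i n) sums (1 / (real n + 1 - u)\<^sup>2 / (real n + 1 - u)
        + 1 / (real n + 1 - u) / (real n + 1 - u)\<^sup>2)"
      by (intro sums_add sums_divide sums_connector sums_connector_shifted_harm)
    then show ?thesis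
      by (simp add: power2_eq_square power3_eq_cube mult_ac)
  qed
  show "(\<lambda>n. 2 * (1 / (real n + 1 - u) ^ 3)) sums (2 * (\<Sum>n. 1 / (real n + 1 - u) ^ 3))"
    by (intro sums_mult summable_sums summable_inverse_pow) simp
qed

end

section \<open>Summation over the largest index\<close>

text \<open>
  With \<open>k = m + 1\<close>, \<open>connector_conv u m\<close> is the convolution
  \<open>x\<^sub>k = \<Sum> e\<^sub>i / (i (j - u))\<close> over \<open>i + j = k\<close>, \<open>i, j \<ge> 1\<close>. The definition of \<open>block_sum\<close> is the
  closed form of the recursion \<open>block_sum_Suc\<close>, which is the one produced by the weighted
  sums. The value \<open>slice_gf u m\<close> is the part of the right-hand generating function in which the
  largest summation index equals \<open>m + 1\<close>.
\<close>
definition connector_conv :: "real \<Rightarrow> nat \<Rightarrow> real" where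
  "connector_conv u m = (\<Sum>j<m. connector u 0 (Suc j) / (real j + 1) * (1 / (real m - real j - u)))"

definition block_sum :: "real \<Rightarrow> nat \<Rightarrow> real" where
  "block_sum u m =
     (shifted_harm u 0 m + u * (\<Sum>l<m. connector_conv u l) - connector u 0 m * harmonic m) / u\<^sup>2"

definition slice_gf :: "real \<Rightarrow> nat \<Rightarrow> real" where
  "slice_gf u m = (2 * connector_conv u m + u * block_sum u m) / ((real m + 1) * (real m + 1 - u))"

context
  fixes u :: real
  assumes u: "0 < u" "u < 1 / 2"
begin

lemma connector_zero_Suc:
  "(real m + 1 - u) * (connector u 0 (Suc m) / (real m + 1)) = connector u 0 m"
  using u by (simp add: connector_Suc)

lemma connector_zero_diff:
  "connector u 0 (Suc m) - connector u 0 m = u * connector u 0 (Suc m) / (real m + 1)"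
  unfolding connector_zero_Suc[of m, symmetric] by (simp add: field_simps)

lemma sum_connector_zero:
  "u * (\<Sum>j<m. connector u 0 (Suc j) / (real j + 1)) = connector u 0 m - 1"
proof (induction m)
  case (Suc m)
  then show ?case using connector_zero_diff[of m] by (simp add: algebra_simps)
qed simp

text \<open>
  Increasing \<open>m\<close> by one and shifting the summation index replaces \<open>e\<^sub>j\<close> by
  \<open>e\<^sub>j\<^sub>+\<^sub>1 = e\<^sub>j + u e\<^sub>j\<^sub>+\<^sub>1 / (j + 1)\<close>; the correction is again a term of the convolution.
\<close>
lemma connector_convolution:
  "(\<Sum>j<m. connector u 0 j * (1 / (real m - real j - u)))
     = shifted_harm u 0 m + u * (\<Sum>l<m. connector_conv u l)"
proof (induction m)
  case (Suc m)
  have "(\<Sum>j<Suc m. connector u 0 j * (1 / (real (Suc m) - real j - u)))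
      = 1 / (real m + 1 - u) + (\<Sum>j<m. connector u 0 (Suc j) * (1 / (real m - real j - u)))"
    by (subst sum.lessThan_Suc_shift) (simp add: connector_0 add_ac)
  also have "(\<Sum>j<m. connector u 0 (Suc j) * (1 / (real m - real j - u)))
      = (\<Sum>j<m. connector u 0 j * (1 / (real m - real j - u))) + u * connector_conv u m"
    unfolding connector_conv_def sum_distrib_left sum.distrib[symmetric]
  proof (rule sum.cong)
    fix j
    have "connector u 0 (Suc j) = connector u 0 j + u * (connector u 0 (Suc j) / (real j + 1))"
      using connector_zero_diff[of j] by simp
    then show "connector u 0 (Suc j) * (1 / (real m - real j - u)) =
         connector u 0 j * (1 / (real m - real j - u))
         + u * (connector u 0 (Suc j) / (real j + 1) * (1 / (real m - real j - u)))"
      by (metis distrib_right mult.assoc)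
  qed simp
  finally show ?case
    using Suc by (simp add: shifted_harm_Suc algebra_simps)
qed simp

text \<open>
  Split the factor \<open>k - 2 u\<close> as \<open>(i - u) + (j - u)\<close> over \<open>i + j = k\<close>: the second part cancels the
  denominator \<open>j - u\<close>, and \<open>(i - u) e\<^sub>i / i = e\<^sub>i\<^sub>-\<^sub>1\<close>. The same recursion governs sums over chains
  with the factor \<open>u / (k - 2 u)\<close> at the doubly weighted positions.
\<close>
lemma connector_conv_rec:
  "(real m + 1 - 2 * u) * connector_conv u m
     = shifted_harm u 0 m + (connector u 0 m - 1) / u + u * (\<Sum>l<m. connector_conv u l)"
proof -
  have "(real m + 1 - 2 * u) * connector_conv u m
      = (\<Sum>j<m. connector u 0 j * (1 / (real m - real j - u)) + connector u 0 (Suc j) / (real j + 1))"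
    unfolding connector_conv_def sum_distrib_left
  proof (rule sum.cong)
    fix j assume "j \<in> {..<m}"
    then have "real m \<ge> real j + 1" by auto
    then have "real m - real j - u > 0" using u by linarith
    then have "(x + (real m - real j - u)) * (c * (1 / (real m - real j - u)))
        = x * c * (1 / (real m - real j - u)) + c" for x c
      by (simp add: field_simps)
    from this[of "real j + 1 - u" "connector u 0 (Suc j) / (real j + 1)"]
    show "(real m + 1 - 2 * u) * (connector u 0 (Suc j) / (real j + 1) * (1 / (real m - real j - u)))
        = connector u 0 j * (1 / (real m - real j - u)) + connector u 0 (Suc j) / (real j + 1)"
      unfolding connector_zero_Suc by (simp add: algebra_simps)
  qed simp
  also have "\<dots> = shifted_harm u 0 m + u * (\<Sum>l<m. connector_conv u l) + (connector u 0 m - 1) / u"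
  proof -
    have "(\<Sum>j<m. connector u 0 (Suc j) / (real j + 1)) = (connector u 0 m - 1) / u"
      using u sum_connector_zero[of m] by (simp add: nonzero_eq_divide_eq mult.commute)
    then show ?thesis
      unfolding sum.distrib connector_convolution by simp
  qed
  finally show ?thesis by simp
qed

lemma connector_conv_rec_scaled:
  "u * (real m + 1 - 2 * u) * connector_conv u m
     = u * shifted_harm u 0 m + (connector u 0 m - 1) + u\<^sup>2 * (\<Sum>l<m. connector_conv u l)"
proof -
  have "u * (a + b / u + u * c) = u * a + b + u\<^sup>2 * c" for a b c
    using u by (simp add: distrib_left power2_eq_square)
  then show ?thesis
    unfolding mult.assoc[of u] connector_conv_rec by simp
qed

text \<open>
  Summing the convolution along \<open>j\<close> first telescopes
  \<open>1 / ((j - u) (i + j - u))\<close> to a shifted harmonic number.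
\<close>
lemma sums_connector_conv:
  "(\<lambda>m. connector_conv u m / (real m + 1 - u)) sums (2 * (\<Sum>n. 1 / (real n + 1 - u) ^ 3))"
proof (rule sums_swap)
  let ?c = "\<lambda>j. connector u 0 (Suc j) / (real j + 1)"
  let ?f = "\<lambda>m j. if j \<in> {..<m} then ?c j * (1 / (real m - real j - u)) / (real m + 1 - u) else 0"
  show "0 \<le> ?f m j" for m j
  proof (cases "j < m")
    case True
    then have "real m \<ge> real j + 1" by auto
    then show ?thesis
      using u connector_pos[OF u, of 0 "Suc j"] by auto
  qed simp
  show "?f m sums (connector_conv u m / (real m + 1 - u))" for m
    using sums_If_finite_set[of "{..<m}" "\<lambda>j. ?c j * (1 / (real m - real j - u)) / (real m + 1 - u)"]
    by (simp add: connector_conv_def sum_divide_distrib)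
  show "(\<lambda>m. ?f m j) sums (connector u 0 (Suc j) / (real j + 1)\<^sup>2 * shifted_harm u 0 (Suc j))" for j
  proof -
    have "(\<lambda>n. shifted_harm u n (Suc j)) \<longlonglongrightarrow> (\<Sum>i<Suc j. 0)"
      unfolding shifted_harm_def
    proof (intro tendsto_sum)
      show "(\<lambda>n. 1 / (real i + 1 + real n - u)) \<longlonglongrightarrow> 0" for i
        by real_asymp
    qed
    then have "(\<lambda>n. shifted_harm u n (Suc j)) \<longlonglongrightarrow> 0"
      by simp
    from sums_mult[OF telescope_sums'[OF this], of "?c j / (real j + 1)"]
    have "(\<lambda>n. ?c j / (real j + 1) * (shifted_harm u n (Suc j) - shifted_harm u (Suc n) (Suc j)))
        sums (connector u 0 (Suc j) / (real j + 1)\<^sup>2 * shifted_harm u 0 (Suc j))"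
      by (simp add: power2_eq_square)
    moreover have "?c j / (real j + 1) * (shifted_harm u n (Suc j) - shifted_harm u (Suc n) (Suc j))
        = ?f (n + Suc j) j" for n
    proof -
      define d where "d = real n + 1 - u"
      define x where "x = real j + 1"
      have pos: "d > 0" "x > 0" using u by (simp_all add: d_def x_def)
      have s: "shifted_harm u n (Suc j) - shifted_harm u (Suc n) (Suc j) = 1 / d - 1 / (x + d)"
        by (subst shifted_harm_shift) (simp add: d_def x_def add_ac algebra_simps)
      have "c / x * (1 / d - 1 / (x + d)) = c * (1 / d) / (x + d)" for c
      proof -
        have "1 / d - 1 / (x + d) = x / (d * (x + d))"
          using pos by (simp add: field_simps)
        then show ?thesis using pos by simp
      qed
      note eq = this
      have shift: "real (n + Suc j) - real j - u = d" "real (n + Suc j) + 1 - u = x + d"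
        by (simp_all add: d_def x_def)
      show ?thesis
        unfolding s shift using eq[of "?c j"] by (simp add: x_def)
    qed
    ultimately have "(\<lambda>n. ?f (n + Suc j) j) sums
        (connector u 0 (Suc j) / (real j + 1)\<^sup>2 * shifted_harm u 0 (Suc j))"
      by simp
    moreover have "?f m j = 0" if "m < Suc j" for m
      using that by simp
    ultimately show ?thesis
      using sums_zero_iff_shift[of "Suc j" "\<lambda>m. ?f m j"] by blast
  qed
  show "(\<lambda>j. connector u 0 (Suc j) / (real j + 1)\<^sup>2 * shifted_harm u 0 (Suc j)) sums
      (2 * (\<Sum>n. 1 / (real n + 1 - u) ^ 3))"
    by (rule sums_connector_zero_shifted_harm[OF u])
qed

text \<open>
  The recursion for the convolution eliminates the partial sums of \<open>connector_conv\<close> hidden in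
  \<open>block_sum\<close>. What remains is a combination of the summands of the three evaluated series.
\<close>
lemma slice_gf_eq:
  "slice_gf u m = (connector_conv u m / (real m + 1 - u)
      - connector u 0 (Suc m) / (real m + 1)\<^sup>2 * harmonic m
      - (connector u 0 (Suc m) / (real m + 1)\<^sup>2 - 1 / ((real m + 1) * (real m + 1 - u))) / u) / u"
proof -
  define x where "x = real m + 1"
  define Y where "Y = (\<Sum>l<m. connector_conv u l)"
  define e where "e = connector u 0 m"
  have pos: "x > 0" "x - u > 0" using u by (simp_all add: x_def)
  have e: "connector u 0 (Suc m) = e * x / (x - u)"
    by (simp add: e_def x_def connector_Suc)
  have rec: "(x - 2 * u) * connector_conv u m = shifted_harm u 0 m + (e - 1) / u + u * Y"
    using connector_conv_rec[of m] by (simp add: x_def Y_def e_def)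
  have "slice_gf u m = (2 * u * connector_conv u m + (shifted_harm u 0 m + u * Y - e * harmonic m)) / (x * (x - u)) / u"
  proof -
    have "2 * a + u * (b / u\<^sup>2) = (2 * u * a + b) / u" for a b
      using u by (simp add: add_divide_distrib power2_eq_square)
    then show ?thesis
      unfolding slice_gf_def block_sum_def by (simp add: x_def Y_def e_def)
  qed
  also have "2 * u * connector_conv u m + (shifted_harm u 0 m + u * Y - e * harmonic m)
      = x * connector_conv u m - e * harmonic m - (e - 1) / u"
    using rec by (simp add: algebra_simps)
  also have "(x * connector_conv u m - e * harmonic m - (e - 1) / u) / (x * (x - u))
      = connector_conv u m / (x - u) - e * x / (x - u) / x\<^sup>2 * harmonic m
        - (e * x / (x - u) / x\<^sup>2 - 1 / (x * (x - u))) / u"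
  proof -
    have "e * x / (x - u) / x\<^sup>2 = e / (x * (x - u))"
      using pos by (simp add: power2_eq_square)
    moreover have "connector_conv u m / (x - u) = x * connector_conv u m / (x * (x - u))"
      using pos by simp
    ultimately show ?thesis
      by (simp add: diff_divide_distrib mult_ac)
  qed
  finally show ?thesis
    by (simp add: e x_def)
qed

lemma sums_slice_gf: "slice_gf u sums (\<Sum>n. 1 / ((real n + 1) * (real n + 1 - u) ^ 3))"
proof -
  let ?d = "\<lambda>n. real n + 1 - u"
  have Z: "summable (\<lambda>n. 1 / ((real n + 1) * ?d n))"
  proof (rule summable_comparison_test'[OF summable_inverse_pow[OF u, of 2]])
    show "norm (1 / ((real n + 1) * ?d n)) \<le> 1 / (?d n)\<^sup>2" for n
      using u by (auto simp: power2_eq_square intro!: divide_left_mono mult_right_mono mult_pos_pos)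
  qed simp
  let ?S3 = "\<Sum>n. 1 / ?d n ^ 3" and ?S2 = "\<Sum>n. 1 / (?d n)\<^sup>2"
  let ?Z = "\<Sum>n. 1 / ((real n + 1) * ?d n)"
  have "slice_gf u sums ((2 * ?S3 - ?S3 - (?S2 - ?Z) / u) / u)"
    unfolding slice_gf_eq
    by (intro sums_divide sums_diff sums_connector_conv sums_connector_zero[OF u] sums_connector_zero_harmonic[OF u] summable_sums Z)
  moreover have "(\<lambda>n. (2 * (1 / ?d n ^ 3) - 1 / ?d n ^ 3
        - (1 / (?d n)\<^sup>2 - 1 / ((real n + 1) * ?d n)) / u) / u)
      sums ((2 * ?S3 - ?S3 - (?S2 - ?Z) / u) / u)"
    by (intro sums_divide sums_diff sums_mult summable_sums Z summable_inverse_pow[OF u]) simp_all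
  moreover have "(2 * (1 / ?d n ^ 3) - 1 / ?d n ^ 3
        - (1 / (?d n)\<^sup>2 - 1 / ((real n + 1) * ?d n)) / u) / u = 1 / ((real n + 1) * ?d n ^ 3)" for n
  proof -
    define d where "d = ?d n"
    define x where "x = real n + 1"
    have pos: "d > 0" "x > 0" and diff: "x - d = u" using u by (simp_all add: d_def x_def)
    have "1 / d\<^sup>2 - 1 / (x * d) = (x - d) / (x * d\<^sup>2)"
      using pos by (simp add: field_simps power2_eq_square)
    then have "(2 * (1 / d ^ 3) - 1 / d ^ 3 - (1 / d\<^sup>2 - 1 / (x * d)) / u) / u
        = (1 / d ^ 3 - 1 / (x * d\<^sup>2)) / u"
      using u by (simp add: diff)
    also have "1 / d ^ 3 - 1 / (x * d\<^sup>2) = (x - d) / (x * d ^ 3)"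
      using pos by (simp add: field_simps power2_eq_square power3_eq_cube)
    finally have "(2 * (1 / d ^ 3) - 1 / d ^ 3 - (1 / d\<^sup>2 - 1 / (x * d)) / u) / u
        = 1 / (x * d ^ 3)"
      using u by (simp add: diff)
    then show ?thesis
      unfolding d_def x_def .
  qed
  ultimately show ?thesis
    by (simp add: sums_iff)
qed

end

section \<open>Generating functions of weighted truncated sums\<close>

text \<open>
  Exponents are read from the last one, which belongs to the largest index, so lists are kept
  reversed: recursion on the list strips the largest index. All indices are at most \<open>m\<close>.
\<close>
fun trunc_mzv :: "nat list \<Rightarrow> nat \<Rightarrow> real" where
  "trunc_mzv [] m = 1"
| "trunc_mzv (x # xs) m = (\<Sum>j<m. trunc_mzv xs j / (real j + 1) ^ x)"

definition words :: "nat \<Rightarrow> nat list set" where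
  "words q = {xs. (\<forall>x\<in>set xs. 1 \<le> x) \<and> sum_list xs = q}"

text \<open>
  \<open>trunc_total\<close> is the coefficient of \<open>u\<^sup>q\<close> in a weighted sum over all exponent words with all
  indices at most \<open>m\<close>; \<open>top_slice\<close> collects the nonempty words with largest index exactly \<open>m + 1\<close>.
\<close>
definition top_slice :: "(nat list \<Rightarrow> real) \<Rightarrow> nat \<Rightarrow> nat \<Rightarrow> real" where
  "top_slice w m q = (\<Sum>xs\<in>words q - {[]}. w xs * (trunc_mzv (tl xs) m / (real m + 1) ^ hd xs))"

definition trunc_total :: "(nat list \<Rightarrow> real) \<Rightarrow> nat \<Rightarrow> nat \<Rightarrow> real" where
  "trunc_total w m q = (\<Sum>xs\<in>words q. w xs * trunc_mzv xs m)"

text \<open>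
  The weights describe how much of the pattern of \<open>W\<close> has been read when the list ends, summed
  over all admissible \<open>a\<close> and \<open>b\<close>, with \<open>a = 0\<close> counted twice because it also occurs in the
  restricted sums: \<open>head_weight\<close> when every position so far belongs to the first block of length
  \<open>a + 1\<close>; \<open>mid_weight\<close> when the position with the factor \<open>2 ^ (x - 1) - 1\<close> is still to come;
  \<open>tail_weight\<close> when it has been passed. In \<open>word_weight\<close> the case \<open>c = 0\<close> is counted twice as well.
\<close>
fun head_weight :: "nat list \<Rightarrow> real" where
  "head_weight [] = 0"
| "head_weight (x # xs) = 1 + (if xs = [] then 1 else 0)"

fun mid_weight :: "nat list \<Rightarrow> real" where
  "mid_weight [] = 0"
| "mid_weight (x # xs) = head_weight (x # xs) + 2 ^ (x - 1) * mid_weight xs"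

fun tail_weight :: "nat list \<Rightarrow> real" where
  "tail_weight [] = 0"
| "tail_weight (x # xs) = (2 ^ (x - 1) - 1) * mid_weight xs + tail_weight xs"

fun word_weight :: "nat list \<Rightarrow> real" where
  "word_weight [] = 0"
| "word_weight (x # xs) = 2 * ((2 ^ (x - 1) - 1) * mid_weight xs) + tail_weight xs"

lemma trunc_mzv_nonneg: "0 \<le> trunc_mzv xs m"
  by (induction xs arbitrary: m) (auto intro!: sum_nonneg)

lemma head_weight_nonneg: "0 \<le> head_weight xs"
  by (cases xs) auto

lemma mid_weight_nonneg: "0 \<le> mid_weight xs"
  by (induction xs) (auto simp del: head_weight.simps intro!: add_nonneg_nonneg head_weight_nonneg)

lemma tail_weight_nonneg: "0 \<le> tail_weight xs"
  by (induction xs) (auto intro!: add_nonneg_nonneg mult_nonneg_nonneg mid_weight_nonneg)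

lemma word_weight_nonneg: "0 \<le> word_weight xs"
  by (cases xs) (auto intro!: add_nonneg_nonneg mult_nonneg_nonneg mid_weight_nonneg tail_weight_nonneg)

lemma length_le_sum_list: "\<forall>x\<in>set xs. 1 \<le> (x::nat) \<Longrightarrow> length xs \<le> sum_list xs"
  by (induction xs) auto

lemma finite_words: "finite (words q)"
proof (rule finite_subset)
  show "words q \<subseteq> {xs. set xs \<subseteq> {..q} \<and> length xs \<le> q}"
    using length_le_sum_list member_le_sum_list by (fastforce simp: words_def)
qed (simp add: finite_lists_length_le)

lemma words_0: "words 0 = {[]}"
proof -
  have "xs = []" if "\<forall>x\<in>set xs. 1 \<le> x" "sum_list xs = 0" for xs :: "nat list"
    using that by (cases xs) auto
  then show ?thesis
    by (auto simp: words_def)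
qed

lemma words_nonempty:
  "words q - {[]} = (\<lambda>(x, xs). x # xs) ` (SIGMA x:{1..q}. words (q - x))"
proof (intro equalityI subsetI)
  fix ys assume "ys \<in> words q - {[]}"
  then obtain x xs where "ys = x # xs" "x \<in> {1..q}" "xs \<in> words (q - x)"
    by (cases ys) (auto simp: words_def)
  then show "ys \<in> (\<lambda>(x, xs). x # xs) ` (SIGMA x:{1..q}. words (q - x))"
    by force
qed (auto simp: words_def)

lemma sum_words:
  "(\<Sum>xs\<in>words q - {[]}. F (hd xs) (tl xs)) = (\<Sum>x=1..q. \<Sum>xs\<in>words (q - x). F x xs)"
proof -
  have inj: "inj_on (\<lambda>(x, xs). x # xs) (SIGMA x:{1..q}. words (q - x))"
    by (auto simp: inj_on_def)
  show ?thesis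
    unfolding words_nonempty sum.reindex[OF inj]
    by (simp add: sum.Sigma finite_words case_prod_unfold o_def)
qed

lemma top_slice_nonneg: "(\<And>xs. 0 \<le> w xs) \<Longrightarrow> 0 \<le> top_slice w m q"
  unfolding top_slice_def by (intro sum_nonneg mult_nonneg_nonneg divide_nonneg_nonneg trunc_mzv_nonneg) auto

lemma trunc_total_nonneg: "(\<And>xs. 0 \<le> w xs) \<Longrightarrow> 0 \<le> trunc_total w m q"
  unfolding trunc_total_def by (intro sum_nonneg mult_nonneg_nonneg trunc_mzv_nonneg)

lemma trunc_total_eq:
  "trunc_total w m q = (if q = 0 then w [] else 0) + (\<Sum>j<m. top_slice w j q)"
proof -
  have "(\<Sum>xs\<in>words q - {[]}. w xs * trunc_mzv xs m) = (\<Sum>j<m. top_slice w j q)"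
    unfolding top_slice_def sum.swap[of _ "words q - {[]}" "{..<m}"]
  proof (intro sum.cong refl)
    fix xs assume "xs \<in> words q - {[]}"
    then show "w xs * trunc_mzv xs m
        = (\<Sum>j<m. w xs * (trunc_mzv (tl xs) j / (real j + 1) ^ hd xs))"
      by (cases xs) (simp_all add: sum_distrib_left)
  qed
  moreover have "trunc_total w m q = (if q = 0 then w [] else 0)
      + (\<Sum>xs\<in>words q - {[]}. w xs * trunc_mzv xs m)"
  proof (cases "q = 0")
    case False
    then have "[] \<notin> words q"
      by (simp add: words_def)
    then show ?thesis
      using False by (simp add: trunc_total_def)
  qed (simp add: trunc_total_def words_0)
  ultimately show ?thesis by simp
qed

lemma top_slice_eq:
  assumes w: "\<And>x xs. 1 \<le> x \<Longrightarrow> w (x # xs) = g x * v xs" and g: "g 0 = 0"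
  shows "top_slice w m q = (\<Sum>x\<le>q. g x / (real m + 1) ^ x * trunc_total v m (q - x))"
proof -
  have "top_slice w m q = (\<Sum>xs\<in>words q - {[]}.
      g (hd xs) * v (tl xs) * (trunc_mzv (tl xs) m / (real m + 1) ^ hd xs))"
    unfolding top_slice_def
  proof (intro sum.cong refl)
    fix xs assume "xs \<in> words q - {[]}"
    then show "w xs * (trunc_mzv (tl xs) m / (real m + 1) ^ hd xs)
        = g (hd xs) * v (tl xs) * (trunc_mzv (tl xs) m / (real m + 1) ^ hd xs)"
      by (cases xs) (auto simp: words_def w)
  qed
  also have "\<dots> = (\<Sum>x=1..q. \<Sum>xs\<in>words (q - x).
      g x * v xs * (trunc_mzv xs m / (real m + 1) ^ x))"
    by (rule sum_words[where F = "\<lambda>x xs. g x * v xs * (trunc_mzv xs m / (real m + 1) ^ x)"])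
  also have "\<dots> = (\<Sum>x=1..q. g x / (real m + 1) ^ x * trunc_total v m (q - x))"
  proof (rule sum.cong)
    fix x
    show "(\<Sum>xs\<in>words (q - x). g x * v xs * (trunc_mzv xs m / (real m + 1) ^ x))
        = g x / (real m + 1) ^ x * trunc_total v m (q - x)"
      unfolding trunc_total_def sum_distrib_left by (rule sum.cong) simp_all
  qed simp
  also have "\<dots> = (\<Sum>x\<le>q. g x / (real m + 1) ^ x * trunc_total v m (q - x))"
  proof (rule sum.mono_neutral_left)
    show "\<forall>x\<in>{..q} - {1..q}. g x / (real m + 1) ^ x * trunc_total v m (q - x) = 0"
    proof
      fix x assume "x \<in> {..q} - {1..q}"
      then have "x = 0" by auto
      then show "g x / (real m + 1) ^ x * trunc_total v m (q - x) = 0" by (simp add: g)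
    qed
  qed auto
  finally show ?thesis .
qed

context
  fixes u :: real
  assumes u: "0 < u" "u < 1 / 2"
begin

lemma trunc_total_sums:
  assumes "\<And>j. j < m \<Longrightarrow> (\<lambda>q. top_slice w j q * u ^ q) sums l j"
  shows "(\<lambda>q. trunc_total w m q * u ^ q) sums (w [] + (\<Sum>j<m. l j))"
proof -
  have "(\<lambda>q. if q = 0 then w [] * u ^ q else 0) sums (w [] * u ^ 0)"
    by (rule sums_single)
  then have "(\<lambda>q. (if q = 0 then w [] * u ^ q else 0) + (\<Sum>j<m. top_slice w j q * u ^ q)) sums
      (w [] * u ^ 0 + (\<Sum>j<m. l j))"
    by (rule sums_add) (rule sums_sum, use assms in auto)
  moreover have "trunc_total w m q * u ^ q
      = (if q = 0 then w [] * u ^ q else 0) + (\<Sum>j<m. top_slice w j q * u ^ q)" for q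
    unfolding trunc_total_eq[of w m q] by (simp add: sum_distrib_right)
  ultimately show ?thesis by simp
qed

text \<open>
  If the weight of the last entry splits off as \<open>g x\<close>, summing over that entry multiplies the
  generating function by a local factor at the index \<open>m + 1\<close>; this is a Cauchy product.
\<close>
lemma top_slice_sums:
  assumes w: "\<And>x xs. 1 \<le> x \<Longrightarrow> w (x # xs) = g x * v xs" and g: "g 0 = 0"
    and nonneg: "\<And>x. 0 \<le> g x" "\<And>xs. 0 \<le> v xs"
    and sums_g: "(\<lambda>x. g x * (u / (real m + 1)) ^ x) sums a"
    and sums_v: "(\<lambda>q. trunc_total v m q * u ^ q) sums b"
  shows "(\<lambda>q. top_slice w m q * u ^ q) sums (a * b)"
proof -
  have "0 \<le> g x * (u / (real m + 1)) ^ x" for x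
    using u nonneg(1)[of x] by (intro mult_nonneg_nonneg zero_le_power) simp_all
  then have "summable (\<lambda>x. norm (g x * (u / (real m + 1)) ^ x))"
    using sums_summable[OF sums_g] by (simp only: real_norm_def abs_of_nonneg)
  moreover have "0 \<le> trunc_total v m q * u ^ q" for q
    using u trunc_total_nonneg[OF nonneg(2)] by simp
  then have "summable (\<lambda>q. norm (trunc_total v m q * u ^ q))"
    using sums_summable[OF sums_v] by (simp only: real_norm_def abs_of_nonneg)
  ultimately have "(\<lambda>q. \<Sum>x\<le>q. g x * (u / (real m + 1)) ^ x * (trunc_total v m (q - x) * u ^ (q - x)))
      sums (a * b)"
    unfolding sums_unique[OF sums_g] sums_unique[OF sums_v] by (rule Cauchy_product_sums)
  moreover have "top_slice w m q * u ^ q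
      = (\<Sum>x\<le>q. g x * (u / (real m + 1)) ^ x * (trunc_total v m (q - x) * u ^ (q - x)))" for q
  proof -
    have "top_slice w m q = (\<Sum>x\<le>q. g x / (real m + 1) ^ x * trunc_total v m (q - x))"
      by (rule top_slice_eq) (simp_all add: w g)
    then have "top_slice w m q * u ^ q = (\<Sum>x\<le>q. g x / (real m + 1) ^ x * trunc_total v m (q - x) * u ^ q)"
      by (simp only: sum_distrib_right)
    also have "\<dots> = (\<Sum>x\<le>q. g x * (u / (real m + 1)) ^ x * (trunc_total v m (q - x) * u ^ (q - x)))"
    proof (rule sum.cong)
      fix x assume "x \<in> {..q}"
      then have "u ^ q = u ^ x * u ^ (q - x)"
        by (simp flip: power_add)
      then show "g x / (real m + 1) ^ x * trunc_total v m (q - x) * u ^ q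
          = g x * (u / (real m + 1)) ^ x * (trunc_total v m (q - x) * u ^ (q - x))"
        by (simp add: power_divide)
    qed simp
    finally show ?thesis .
  qed
  ultimately show ?thesis by simp
qed

lemma top_slice_add_sums:
  assumes "\<And>x xs. w (x # xs) = wl (x # xs) + wr (x # xs)"
    and "(\<lambda>q. top_slice wl m q * u ^ q) sums a" "(\<lambda>q. top_slice wr m q * u ^ q) sums b"
  shows "(\<lambda>q. top_slice w m q * u ^ q) sums (a + b)"
proof -
  have "top_slice w m q = top_slice wl m q + top_slice wr m q" for q
    unfolding top_slice_def sum.distrib[symmetric]
  proof (intro sum.cong refl)
    fix xs assume "xs \<in> words q - {[]}"
    then show "w xs * (trunc_mzv (tl xs) m / (real m + 1) ^ hd xs) =
        wl xs * (trunc_mzv (tl xs) m / (real m + 1) ^ hd xs) +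
        wr xs * (trunc_mzv (tl xs) m / (real m + 1) ^ hd xs)"
      by (cases xs) (auto simp: assms(1) distrib_right add_divide_distrib)
  qed
  then show ?thesis
    using sums_add[OF assms(2,3)] by (simp add: distrib_right)
qed

lemma geometric_from_one:
  fixes z c :: real
  assumes "0 \<le> c" "\<bar>c * z\<bar> < 1"
  shows "(\<lambda>x. (if x = 0 then 0 else c ^ (x - 1)) * z ^ x) sums (z / (1 - c * z))"
proof -
  have "(\<lambda>x. z * (c * z) ^ x) sums (z * (1 / (1 - c * z)))"
    by (intro sums_mult geometric_sums) (use assms in simp)
  then have "(\<lambda>x. (if Suc x = 0 then 0 else c ^ (Suc x - 1)) * z ^ Suc x) sums (z / (1 - c * z))"
    by (simp add: power_mult_distrib mult_ac)
  then show ?thesis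
    by (subst (asm) sums_Suc_iff) simp
qed

lemma single_gf:
  "(\<lambda>x. (if x = 0 then 0 else 1) * (u / (real m + 1)) ^ x) sums (u / (real m + 1 - u))"
proof -
  have "u / (real m + 1) / (1 - 1 * (u / (real m + 1))) = u / (real m + 1 - u)"
    using u by (simp add: divide_simps)
  moreover have "(\<lambda>x. (if x = 0 then 0 else 1 ^ (x - 1)) * (u / (real m + 1)) ^ x)
      sums (u / (real m + 1) / (1 - 1 * (u / (real m + 1))))"
    by (rule geometric_from_one) (use u in simp_all)
  ultimately show ?thesis
    by (simp only: power_one)
qed

lemma double_gf:
  "(\<lambda>x. (if x = 0 then 0 else 2 ^ (x - 1)) * (u / (real m + 1)) ^ x) sums (u / (real m + 1 - 2 * u))"
proof -
  have "u / (real m + 1) / (1 - 2 * (u / (real m + 1))) = u / (real m + 1 - 2 * u)"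
    using u by (simp add: divide_simps)
  moreover have "(\<lambda>x. (if x = 0 then 0 else 2 ^ (x - 1)) * (u / (real m + 1)) ^ x)
      sums (u / (real m + 1) / (1 - 2 * (u / (real m + 1))))"
    by (rule geometric_from_one) (use u in simp_all)
  ultimately show ?thesis
    by (simp only:)
qed

lemma diff_gf:
  "(\<lambda>x. (if x = 0 then 0 else 2 ^ (x - 1) - 1) * (u / (real m + 1)) ^ x)
     sums (u\<^sup>2 / ((real m + 1 - u) * (real m + 1 - 2 * u)))"
proof -
  define x where "x = real m + 1"
  have pos: "x - u > 0" "x - 2 * u > 0" using u by (simp_all add: x_def)
  have "u / (x - 2 * u) - u / (x - u) = u\<^sup>2 / ((x - u) * (x - 2 * u))"
    using pos by (simp add: field_simps power2_eq_square)
  moreover have "(if n = 0 then 0 else a - 1) * z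
      = (if n = 0 then 0 else a) * z - (if n = 0 then 0 else 1) * z" for n :: nat and a z :: real
    by (simp add: left_diff_distrib)
  ultimately show ?thesis
    using sums_diff[OF double_gf[of m] single_gf[of m]] by (simp only: x_def)
qed

lemma sum_connector_zero_quotient:
  "(\<Sum>j<m. u / (real j + 1 - u) * connector u 0 j) = connector u 0 m - 1"
proof -
  have "u / (real j + 1 - u) * connector u 0 j = u * (connector u 0 (Suc j) / (real j + 1))" for j
    using u by (simp add: connector_Suc)
  then show ?thesis
    using sum_connector_zero[OF u, of m] by (simp add: sum_distrib_left)
qed

text \<open>
  Unweighted words contribute \<open>1 + u / (j - u) = j / (j - u)\<close> for every admissible index \<open>j\<close>,
  which may be skipped or used with any exponent.
\<close>
lemma trunc_total_one_sums: "(\<lambda>q. trunc_total (\<lambda>_. 1) m q * u ^ q) sums connector u 0 m"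
proof (induction m rule: less_induct)
  case (less m)
  have "(\<lambda>q. trunc_total (\<lambda>_. 1) m q * u ^ q) sums (1 + (\<Sum>j<m. u / (real j + 1 - u) * connector u 0 j))"
    by (intro trunc_total_sums top_slice_sums[where g = "\<lambda>x. if x = 0 then 0 else 1" and v = "\<lambda>_. 1"]
        single_gf less) auto
  then show ?case unfolding sum_connector_zero_quotient by simp
qed

lemma top_slice_head_weight_sums:
  "(\<lambda>q. top_slice head_weight m q * u ^ q) sums (u / (real m + 1 - u) * (connector u 0 m + 1))"
proof (rule top_slice_sums[where g = "\<lambda>x. if x = 0 then 0 else 1"
      and v = "\<lambda>xs. 1 + (if xs = [] then 1 else 0)"])
  have "trunc_total (\<lambda>xs. 1 + (if xs = [] then 1 else 0)) m q * u ^ q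
      = trunc_total (\<lambda>_. 1) m q * u ^ q + (if q = 0 then 1 else 0)" for q
  proof -
    have "(\<Sum>xs\<in>words q. (if xs = [] then 1 else 0) * trunc_mzv xs m) = (if q = 0 then 1 else 0)"
    proof -
      have "(\<Sum>xs\<in>words q. (if xs = [] then 1 else 0) * trunc_mzv xs m)
          = (\<Sum>xs\<in>words q. if xs = [] then 1 else 0)"
        by (intro sum.cong) auto
      then show ?thesis
        using finite_words[of q] by (auto simp: words_def)
    qed
    then show ?thesis
      by (simp add: trunc_total_def distrib_right sum.distrib)
  qed
  then show "(\<lambda>q. trunc_total (\<lambda>xs. 1 + (if xs = [] then 1 else 0)) m q * u ^ q) sums (connector u 0 m + 1)"
    using sums_add[OF trunc_total_one_sums[of m] sums_single[of 0 "\<lambda>_. 1"]] by simp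
qed (auto intro: single_gf)

text \<open>
  Stripping the largest index shows that this generating function and the right-hand side satisfy
  the same recursion, by \<open>connector_conv_rec\<close>.
\<close>
lemma trunc_total_mid_weight_sums:
  "(\<lambda>q. trunc_total mid_weight m q * u ^ q) sums (u * (real m + 1 - 2 * u) * connector_conv u m)"
proof (induction m rule: less_induct)
  case (less m)
  have "(\<lambda>q. top_slice mid_weight j q * u ^ q) sums
      (u / (real j + 1 - u) * (connector u 0 j + 1) + u\<^sup>2 * connector_conv u j)" if "j < m" for j
  proof (rule top_slice_add_sums[where wr = "\<lambda>xs. if xs = [] then 0 else 2 ^ (hd xs - 1) * mid_weight (tl xs)",
        OF _ top_slice_head_weight_sums])
    have "(\<lambda>q. top_slice (\<lambda>xs. if xs = [] then 0 else 2 ^ (hd xs - 1) * mid_weight (tl xs)) j q * u ^ q) sums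
        (u / (real j + 1 - 2 * u) * (u * (real j + 1 - 2 * u) * connector_conv u j))"
      by (rule top_slice_sums[OF _ _ _ _ double_gf less[OF that]]) (auto intro: mid_weight_nonneg)
    then show "(\<lambda>q. top_slice (\<lambda>xs. if xs = [] then 0 else 2 ^ (hd xs - 1) * mid_weight (tl xs)) j q * u ^ q)
        sums (u\<^sup>2 * connector_conv u j)"
      using u by (simp add: power2_eq_square mult.assoc)
  qed simp
  then have "(\<lambda>q. trunc_total mid_weight m q * u ^ q) sums
      (mid_weight [] + (\<Sum>j<m. u / (real j + 1 - u) * (connector u 0 j + 1) + u\<^sup>2 * connector_conv u j))"
    by (rule trunc_total_sums)
  moreover have "(\<Sum>j<m. u / (real j + 1 - u) * (connector u 0 j + 1) + u\<^sup>2 * connector_conv u j)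
      = (connector u 0 m - 1) + u * shifted_harm u 0 m + u\<^sup>2 * (\<Sum>j<m. connector_conv u j)"
    unfolding sum.distrib distrib_left sum_connector_zero_quotient
    by (simp add: shifted_harm_def sum_distrib_left)
  moreover have "u * (real m + 1 - 2 * u) * connector_conv u m = \<dots>"
    unfolding connector_conv_rec_scaled[OF u] by simp
  ultimately show ?case by simp
qed

text \<open>
  The closed form satisfies the recursion that arises when the largest index of a chain either
  carries the factor \<open>2 ^ (x - 1) - 1\<close> or is one of the later, unweighted ones.
\<close>
lemma block_sum_Suc:
  "block_sum u (Suc m) - block_sum u m = (connector_conv u m + u * block_sum u m) / (real m + 1 - u)"
proof -
  define x where "x = real m + 1"
  define e where "e = connector u 0 m"
  define Y where "Y = (\<Sum>l<m. connector_conv u l)"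
  have pos: "x > 0" "x - u > 0" using u by (simp_all add: x_def)
  have B: "u\<^sup>2 * block_sum u m = shifted_harm u 0 m + u * Y - e * harmonic m"
    using u by (simp add: block_sum_def Y_def e_def)
  have "u\<^sup>2 * block_sum u (Suc m)
      = shifted_harm u 0 m + 1 / (x - u) + u * (Y + connector_conv u m) - e * x / (x - u) * (harmonic m + 1 / x)"
    using u by (simp add: block_sum_def Y_def e_def x_def shifted_harm_Suc connector_Suc add_ac)
  also have "\<dots> = shifted_harm u 0 m + u * (Y + connector_conv u m)
      + (1 - e * (x * harmonic m + 1)) / (x - u)"
  proof -
    have "e * x / (x - u) * (harmonic m + 1 / x) = e * (x * harmonic m + 1) / (x - u)"
      using pos by (simp add: field_simps)
    then show ?thesis by (simp add: diff_divide_distrib)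
  qed
  finally have B': "u\<^sup>2 * block_sum u (Suc m) = \<dots>" .
  have rec: "u * ((x - 2 * u) * connector_conv u m) = u * shifted_harm u 0 m + (e - 1) + u\<^sup>2 * Y"
    using connector_conv_rec_scaled[OF u, of m] by (simp add: x_def e_def Y_def mult.assoc)
  have "(x - u) * (u\<^sup>2 * (block_sum u (Suc m) - block_sum u m))
      = (x - u) * (u * connector_conv u m + e * harmonic m) + (1 - e * (x * harmonic m + 1))"
  proof -
    have "(x - u) * (h + u * (Y + c) + s / (x - u) - (h + u * Y - p)) = (x - u) * (u * c + p) + s"
      for h c s p
      using pos by (simp add: distrib_left right_diff_distrib)
    then show ?thesis
      unfolding right_diff_distrib[of "u\<^sup>2"] B B' .
  qed
  also have "\<dots> = u\<^sup>2 * connector_conv u m + u * (u\<^sup>2 * block_sum u m)"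
    unfolding B using rec by (simp add: algebra_simps power2_eq_square)
  also have "\<dots> = u\<^sup>2 * (connector_conv u m + u * block_sum u m)"
    by (simp add: algebra_simps)
  finally have "u\<^sup>2 * ((x - u) * (block_sum u (Suc m) - block_sum u m))
      = u\<^sup>2 * (connector_conv u m + u * block_sum u m)"
    by (simp only: mult.left_commute)
  then have "(x - u) * (block_sum u (Suc m) - block_sum u m) = connector_conv u m + u * block_sum u m"
    using u by simp
  then show ?thesis
    using pos by (simp add: x_def nonzero_eq_divide_eq mult.commute)
qed

lemma trunc_total_tail_weight_sums:
  "(\<lambda>q. trunc_total tail_weight m q * u ^ q) sums (u ^ 3 * block_sum u m)"
  and top_slice_last_block_sums:
  "(\<lambda>q. top_slice (\<lambda>xs. if xs = [] then 0 else (2 ^ (hd xs - 1) - 1) * mid_weight (tl xs)) m q * u ^ q)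
        sums (u ^ 3 * connector_conv u m / (real m + 1 - u))"
proof -
  have D: "(\<lambda>q. top_slice (\<lambda>xs. if xs = [] then 0 else (2 ^ (hd xs - 1) - 1) * mid_weight (tl xs)) j q * u ^ q)
        sums (u ^ 3 * connector_conv u j / (real j + 1 - u))" for j
  proof -
    have "(\<lambda>q. top_slice (\<lambda>xs. if xs = [] then 0 else (2 ^ (hd xs - 1) - 1) * mid_weight (tl xs)) j q * u ^ q)
        sums (u\<^sup>2 / ((real j + 1 - u) * (real j + 1 - 2 * u)) * (u * (real j + 1 - 2 * u) * connector_conv u j))"
      by (rule top_slice_sums[OF _ _ _ _ diff_gf trunc_total_mid_weight_sums]) (auto intro: mid_weight_nonneg)
    then show ?thesis
      using u by (simp add: power2_eq_square power3_eq_cube mult_ac)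
  qed
  then show "(\<lambda>q. top_slice (\<lambda>xs. if xs = [] then 0 else (2 ^ (hd xs - 1) - 1) * mid_weight (tl xs)) m q * u ^ q)
        sums (u ^ 3 * connector_conv u m / (real m + 1 - u))" .
  show "(\<lambda>q. trunc_total tail_weight m q * u ^ q) sums (u ^ 3 * block_sum u m)"
  proof (induction m rule: less_induct)
    case (less m)
    have "(\<lambda>q. top_slice tail_weight j q * u ^ q) sums
        (u ^ 3 * connector_conv u j / (real j + 1 - u) + u / (real j + 1 - u) * (u ^ 3 * block_sum u j))"
      if "j < m" for j
    proof (rule top_slice_add_sums[OF _ D])
      show "(\<lambda>q. top_slice (\<lambda>xs. tail_weight (tl xs)) j q * u ^ q) sums
          (u / (real j + 1 - u) * (u ^ 3 * block_sum u j))"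
        by (rule top_slice_sums[OF _ _ _ _ single_gf less[OF that]]) (auto intro: tail_weight_nonneg)
    qed simp
    moreover have "u ^ 3 * connector_conv u j / (real j + 1 - u) + u / (real j + 1 - u) * (u ^ 3 * block_sum u j)
        = u ^ 3 * (block_sum u (Suc j) - block_sum u j)" for j
      unfolding block_sum_Suc by (simp add: add_divide_distrib distrib_left mult_ac)
    ultimately have "(\<lambda>q. trunc_total tail_weight m q * u ^ q) sums
        (tail_weight [] + (\<Sum>j<m. u ^ 3 * (block_sum u (Suc j) - block_sum u j)))"
      by (intro trunc_total_sums) simp
    moreover have "(\<Sum>j<m. u ^ 3 * (block_sum u (Suc j) - block_sum u j)) = u ^ 3 * block_sum u m"
      unfolding sum_distrib_left[symmetric] sum_lessThan_telescope
      by (simp add: block_sum_def shifted_harm_0)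
    ultimately show ?case by simp
  qed
qed

lemma top_slice_word_weight_sums:
  "(\<lambda>q. top_slice word_weight m q * u ^ q) sums (u ^ 3 * (real m + 1) * slice_gf u m)"
proof -
  let ?D = "\<lambda>xs. if xs = [] then 0 else (2 ^ (hd xs - 1) - 1) * mid_weight (tl xs)"
  have "(\<lambda>q. top_slice (\<lambda>xs. tail_weight (tl xs)) m q * u ^ q) sums
      (u / (real m + 1 - u) * (u ^ 3 * block_sum u m))"
    by (rule top_slice_sums[OF _ _ _ _ single_gf trunc_total_tail_weight_sums]) (auto intro: tail_weight_nonneg)
  then have "(\<lambda>q. top_slice (\<lambda>xs. ?D xs + tail_weight (tl xs)) m q * u ^ q) sums
      (u ^ 3 * connector_conv u m / (real m + 1 - u) + u / (real m + 1 - u) * (u ^ 3 * block_sum u m))"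
    by (rule top_slice_add_sums[OF refl top_slice_last_block_sums])
  then have "(\<lambda>q. top_slice word_weight m q * u ^ q) sums (u ^ 3 * connector_conv u m / (real m + 1 - u)
      + (u ^ 3 * connector_conv u m / (real m + 1 - u) + u / (real m + 1 - u) * (u ^ 3 * block_sum u m)))"
    by (rule top_slice_add_sums[OF _ top_slice_last_block_sums, rotated]) simp
  moreover have "u ^ 3 * connector_conv u m / (real m + 1 - u)
      + (u ^ 3 * connector_conv u m / (real m + 1 - u) + u / (real m + 1 - u) * (u ^ 3 * block_sum u m))
      = u ^ 3 * (real m + 1) * slice_gf u m"
    by (simp add: slice_gf_def add_divide_distrib distrib_left mult_ac)
  ultimately show ?thesis by simp
qed

end

section \<open>Multiple zeta values as series over the largest index\<close>

text \<open>
  Finiteness is the reason for the upper bound: the set of all chains of a given length fibres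
  over the largest index with finite fibres, so the defining sum becomes an ordinary series.
\<close>
definition bounded_chains :: "nat \<Rightarrow> nat \<Rightarrow> nat list set" where
  "bounded_chains r m = {ks. length ks = r \<and> sorted_wrt (<) ks \<and> (\<forall>k\<in>set ks. 1 \<le> k \<and> k \<le> m)}"

lemma finite_bounded_chains: "finite (bounded_chains r m)"
  by (rule finite_subset[OF _ finite_lists_length_eq[of "{..m}" r]]) (auto simp: bounded_chains_def)

lemma snoc_bounded_chains:
  "ks @ [k] \<in> bounded_chains (Suc r) m \<longleftrightarrow> 1 \<le> k \<and> k \<le> m \<and> ks \<in> bounded_chains r (k - 1)"
  by (auto simp: bounded_chains_def sorted_wrt_append)

lemma bounded_chains_Suc:
  "bounded_chains (Suc r) m = (\<lambda>(j, ks). ks @ [Suc j]) ` (SIGMA j:{..<m}. bounded_chains r j)"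
proof (intro equalityI subsetI)
  fix ks' assume ks': "ks' \<in> bounded_chains (Suc r) m"
  then obtain ks k where eq: "ks' = ks @ [k]"
    by (cases ks' rule: rev_cases) (auto simp: bounded_chains_def)
  with ks' have "1 \<le> k" "k \<le> m" "ks \<in> bounded_chains r (k - 1)"
    by (auto simp: snoc_bounded_chains)
  then show "ks' \<in> (\<lambda>(j, ks). ks @ [Suc j]) ` (SIGMA j:{..<m}. bounded_chains r j)"
    unfolding eq by (intro image_eqI[where x = "(k - 1, ks)"]) auto
qed (auto simp: snoc_bounded_chains)

lemma chains_eq_Union:
  "{ks. length ks = r \<and> sorted_wrt (<) ks \<and> (\<forall>k\<in>set ks. 1 \<le> k)} = (\<Union>m. bounded_chains r m)"
proof -
  have "\<exists>m. \<forall>k\<in>set ks. k \<le> m" for ks :: "nat list"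
    by (rule exI[of _ "sum_list ks"]) (simp add: member_le_sum_list)
  then show ?thesis
    by (fastforce simp: bounded_chains_def)
qed

lemma chains_Suc_eq_image:
  "{ks. length ks = Suc r \<and> sorted_wrt (<) ks \<and> (\<forall>k\<in>set ks. 1 \<le> k)}
     = (\<lambda>(j, ks). ks @ [Suc j]) ` (SIGMA j:UNIV. bounded_chains r j)"
  unfolding chains_eq_Union bounded_chains_Suc by fastforce

lemma inj_snoc: "inj_on (\<lambda>(j, ks). ks @ [Suc j]) S"
  by (auto simp: inj_on_def)

lemma prod_snoc:
  assumes "length ks = length \<alpha>s"
  shows "(\<Prod>i<length (\<alpha>s @ [x]). 1 / real ((ks @ [k]) ! i) ^ ((\<alpha>s @ [x]) ! i))
      = (\<Prod>i<length \<alpha>s. 1 / real (ks ! i) ^ (\<alpha>s ! i)) * (1 / real k ^ x)"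
  using assms by (simp add: nth_append)

lemma trunc_mzv_eq:
  "trunc_mzv xs m
     = (\<Sum>ks\<in>bounded_chains (length xs) m. \<Prod>i<length (rev xs). 1 / real (ks ! i) ^ (rev xs ! i))"
proof (induction xs arbitrary: m)
  case Nil
  have "bounded_chains 0 m = {[]}" by (auto simp: bounded_chains_def)
  then show ?case by simp
next
  case (Cons x xs)
  have "(\<Sum>ks\<in>bounded_chains (Suc (length xs)) m.
        \<Prod>i<length (rev xs @ [x]). 1 / real (ks ! i) ^ ((rev xs @ [x]) ! i))
      = (\<Sum>(j, ks)\<in>(SIGMA j:{..<m}. bounded_chains (length xs) j).
        \<Prod>i<length (rev xs @ [x]). 1 / real ((ks @ [Suc j]) ! i) ^ ((rev xs @ [x]) ! i))"
    unfolding bounded_chains_Suc sum.reindex[OF inj_snoc] by (simp add: o_def case_prod_unfold)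
  also have "\<dots> = (\<Sum>j<m. \<Sum>ks\<in>bounded_chains (length xs) j.
        \<Prod>i<length (rev xs @ [x]). 1 / real ((ks @ [Suc j]) ! i) ^ ((rev xs @ [x]) ! i))"
    by (simp add: sum.Sigma finite_bounded_chains)
  also have "\<dots> = (\<Sum>j<m. trunc_mzv xs j / (real j + 1) ^ x)"
  proof (rule sum.cong)
    fix j
    have "(\<Sum>ks\<in>bounded_chains (length xs) j.
        \<Prod>i<length (rev xs @ [x]). 1 / real ((ks @ [Suc j]) ! i) ^ ((rev xs @ [x]) ! i))
        = (\<Sum>ks\<in>bounded_chains (length xs) j.
        (\<Prod>i<length (rev xs). 1 / real (ks ! i) ^ (rev xs ! i)) * (1 / real (Suc j) ^ x))"
      by (rule sum.cong[OF refl], rule prod_snoc) (simp add: bounded_chains_def)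
    also have "\<dots> = trunc_mzv xs j / (real j + 1) ^ x"
      unfolding Cons.IH sum_distrib_right[symmetric] by (simp add: add_ac)
    finally show "(\<Sum>ks\<in>bounded_chains (length xs) j.
        \<Prod>i<length (rev xs @ [x]). 1 / real ((ks @ [Suc j]) ! i) ^ ((rev xs @ [x]) ! i))
        = trunc_mzv xs j / (real j + 1) ^ x" .
  qed simp
  finally show ?case by simp
qed

text \<open>
  The summability hypothesis excludes the default value of the infinite sum; where the lemma is
  applied, it comes from the convergence of a generating function with nonnegative terms.
\<close>
lemma mzv_snoc:
  assumes "summable (\<lambda>m. trunc_mzv xs m / (real m + 1) ^ x)"
  shows "mzv (rev xs @ [x]) = (\<Sum>m. trunc_mzv xs m / (real m + 1) ^ x)"
proof -
  define F where "F ks = (\<Prod>i<length (rev xs @ [x]). 1 / real (ks ! i) ^ ((rev xs @ [x]) ! i))"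
    for ks :: "nat list"
  define G where "G ks = (\<Prod>i<length (rev xs). 1 / real (ks ! i) ^ (rev xs ! i))" for ks :: "nat list"
  have F_nonneg: "0 \<le> F ks" for ks
    unfolding F_def by (intro prod_nonneg) auto
  have row: "((\<lambda>ks. F (case (j, ks) of (j, ks) \<Rightarrow> ks @ [Suc j])) has_sum
      (trunc_mzv xs j / (real j + 1) ^ x)) (bounded_chains (length xs) j)" for j
  proof -
    have "(\<Sum>ks\<in>bounded_chains (length xs) j. F (ks @ [Suc j]))
        = (\<Sum>ks\<in>bounded_chains (length xs) j. G ks * (1 / real (Suc j) ^ x))"
      unfolding F_def G_def by (rule sum.cong[OF refl], rule prod_snoc) (simp add: bounded_chains_def)
    also have "\<dots> = trunc_mzv xs j / (real j + 1) ^ x"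
      unfolding trunc_mzv_eq G_def sum_distrib_right[symmetric] by (simp add: add_ac)
    finally show ?thesis
      using has_sum_finite[OF finite_bounded_chains[of "length xs" j], of "\<lambda>ks. F (ks @ [Suc j])"] by simp
  qed
  have sums: "((\<lambda>j. trunc_mzv xs j / (real j + 1) ^ x) has_sum
      (\<Sum>m. trunc_mzv xs m / (real m + 1) ^ x)) UNIV"
    using assms
    by (intro sums_nonneg_imp_has_sum summable_sums divide_nonneg_nonneg trunc_mzv_nonneg) simp_all
  have "((\<lambda>p. F (case p of (j, ks) \<Rightarrow> ks @ [Suc j])) has_sum
      (\<Sum>m. trunc_mzv xs m / (real m + 1) ^ x)) (SIGMA j:UNIV. bounded_chains (length xs) j)"
  proof (rule has_sum_SigmaI[OF row sums])
    show "(\<lambda>p. F (case p of (j, ks) \<Rightarrow> ks @ [Suc j])) summable_on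
        (SIGMA j:UNIV. bounded_chains (length xs) j)"
      by (rule summable_on_SigmaI[OF row has_sum_imp_summable[OF sums]]) (rule F_nonneg)
  qed
  then have "(F has_sum (\<Sum>m. trunc_mzv xs m / (real m + 1) ^ x))
      ((\<lambda>(j, ks). ks @ [Suc j]) ` (SIGMA j:UNIV. bounded_chains (length xs) j))"
    by (subst has_sum_reindex[OF inj_snoc]) (simp add: o_def)
  from infsumI[OF this] show ?thesis
    unfolding mzv_def F_def chains_Suc_eq_image[symmetric] by simp
qed

section \<open>The weights as products over positions\<close>

definition pow_block :: "nat list \<Rightarrow> nat \<Rightarrow> nat \<Rightarrow> real" where
  "pow_block \<alpha>s a s = (\<Prod>j\<in>{a<..s}. 2 ^ (\<alpha>s ! j - 1))"

lemma pow_block_Suc: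
  "a \<le> s \<Longrightarrow> pow_block \<alpha>s a (Suc s) = pow_block \<alpha>s a s * 2 ^ (\<alpha>s ! Suc s - 1)"
proof -
  assume "a \<le> s"
  then have "{a<..Suc s} = insert (Suc s) {a<..s}" by auto
  then show ?thesis by (simp add: pow_block_def)
qed

lemma pow_block_psum:
  assumes "\<forall>x\<in>set \<alpha>s. 1 \<le> x" "a + b < length \<alpha>s"
  shows "2 powi (int (psum \<alpha>s (a + b)) - int (psum \<alpha>s a) - int b) = pow_block \<alpha>s a (a + b)"
  using assms(2)
proof (induction b)
  case (Suc b)
  have "1 \<le> \<alpha>s ! Suc (a + b)"
    using assms(1) Suc.prems by simp
  then have "int (psum \<alpha>s (a + Suc b)) - int (psum \<alpha>s a) - int (Suc b)
      = (int (psum \<alpha>s (a + b)) - int (psum \<alpha>s a) - int b) + int (\<alpha>s ! Suc (a + b) - 1)"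
    by (simp add: psum_def of_nat_diff)
  then have "2 powi (int (psum \<alpha>s (a + Suc b)) - int (psum \<alpha>s a) - int (Suc b))
      = 2 powi (int (psum \<alpha>s (a + b)) - int (psum \<alpha>s a) - int b)
        * (2 :: real) powi (int (\<alpha>s ! Suc (a + b) - 1))"
    using power_int_add[of "2 :: real"] by (simp only:) simp
  then show ?case
    using Suc by (simp add: pow_block_Suc)
qed (simp add: pow_block_def)

lemma W_eq:
  assumes "\<forall>x\<in>set \<alpha>s. 1 \<le> x" "a + b + 1 < length \<alpha>s"
  shows "W \<alpha>s a b c = pow_block \<alpha>s a (a + b) * (2 ^ (\<alpha>s ! (a + b + 1) - 1) - 1)"
proof -
  define x where "x = \<alpha>s ! (a + b + 1)"
  have x: "1 \<le> x" using assms by (simp add: x_def)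
  have "W \<alpha>s a b c = pow_block \<alpha>s a (Suc (a + b)) * (1 - 2 powi (1 - int x))"
    using pow_block_psum[of \<alpha>s a "Suc b"] assms by (simp add: W_def x_def add_ac)
  also have "\<dots> = pow_block \<alpha>s a (a + b) * (2 powi int (x - 1) * (1 - 2 powi (1 - int x)))"
    by (simp add: pow_block_Suc x_def)
  also have "2 powi int (x - 1) * (1 - 2 powi (1 - int x)) = (2 :: real) powi int (x - 1) - 1"
  proof -
    have "(2 :: real) powi int (x - 1) * 2 powi (1 - int x) = 2 powi (int (x - 1) + (1 - int x))"
      by (subst power_int_add) simp_all
    then show ?thesis using x by (simp add: right_diff_distrib of_nat_diff)
  qed
  finally show ?thesis by (simp add: x_def)
qed

text \<open>
  The extra summand is the second contribution of \<open>a = 0\<close>.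
\<close>
definition prefix_weight :: "nat list \<Rightarrow> nat \<Rightarrow> real" where
  "prefix_weight \<alpha>s s = (\<Sum>a\<le>s. pow_block \<alpha>s a s) + pow_block \<alpha>s 0 s"

lemma mid_weight_eq:
  "s < length \<alpha>s \<Longrightarrow> mid_weight (rev (take (Suc s) \<alpha>s)) = prefix_weight \<alpha>s s"
proof (induction s)
  case 0
  then show ?case
    by (simp add: take_Suc_conv_app_nth prefix_weight_def pow_block_def)
next
  case (Suc s)
  have "prefix_weight \<alpha>s (Suc s) = 1 + 2 ^ (\<alpha>s ! Suc s - 1) * prefix_weight \<alpha>s s"
  proof -
    have "(\<Sum>a\<le>Suc s. pow_block \<alpha>s a (Suc s))
        = (\<Sum>a\<le>s. pow_block \<alpha>s a s * 2 ^ (\<alpha>s ! Suc s - 1)) + 1"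
      by (simp add: pow_block_Suc) (simp add: pow_block_def)
    then show ?thesis
      by (simp add: prefix_weight_def pow_block_Suc sum_distrib_right[symmetric] algebra_simps)
  qed
  moreover have "rev (take (Suc (Suc s)) \<alpha>s) = \<alpha>s ! Suc s # rev (take (Suc s) \<alpha>s)"
    using Suc.prems by (simp only: take_Suc_conv_app_nth) simp
  moreover have "take (Suc s) \<alpha>s \<noteq> []"
    using Suc.prems by auto
  ultimately show ?case
    using Suc by (simp del: take_Suc)
qed

lemma tail_weight_eq:
  "s < length \<alpha>s \<Longrightarrow> tail_weight (rev (take (Suc s) \<alpha>s))
     = (\<Sum>t<s. (2 ^ (\<alpha>s ! Suc t - 1) - 1) * prefix_weight \<alpha>s t)"
proof (induction s)
  case 0
  then show ?case by (simp add: take_Suc_conv_app_nth)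
next
  case (Suc s)
  have "rev (take (Suc (Suc s)) \<alpha>s) = \<alpha>s ! Suc s # rev (take (Suc s) \<alpha>s)"
    using Suc.prems by (simp only: take_Suc_conv_app_nth) simp
  then show ?case
    using Suc mid_weight_eq[of s \<alpha>s] by (simp del: take_Suc)
qed

lemma word_weight_eq:
  assumes "length \<alpha>s = m + 2"
  shows "word_weight (rev \<alpha>s) = (\<Sum>t\<le>m. (2 ^ (\<alpha>s ! Suc t - 1) - 1) * prefix_weight \<alpha>s t)
      + (2 ^ (\<alpha>s ! Suc m - 1) - 1) * prefix_weight \<alpha>s m"
proof -
  have "\<alpha>s = take (Suc (Suc m)) \<alpha>s" using assms by simp
  also have "\<dots> = take (Suc m) \<alpha>s @ [\<alpha>s ! Suc m]"
    using assms by (intro take_Suc_conv_app_nth) simp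
  finally have "rev \<alpha>s = rev (take (Suc m) \<alpha>s @ [\<alpha>s ! Suc m])"
    by (rule arg_cong)
  then have "word_weight (rev \<alpha>s) = word_weight (\<alpha>s ! Suc m # rev (take (Suc m) \<alpha>s))"
    by (simp only: rev_append rev.simps append_Cons append_Nil)
  also have "\<dots> = 2 * ((2 ^ (\<alpha>s ! Suc m - 1) - 1) * prefix_weight \<alpha>s m)
      + (\<Sum>t<m. (2 ^ (\<alpha>s ! Suc t - 1) - 1) * prefix_weight \<alpha>s t)"
    using assms by (simp only: word_weight.simps mid_weight_eq[of m \<alpha>s] tail_weight_eq[of m \<alpha>s])
  finally show ?thesis
    by (simp add: lessThan_Suc_atMost[symmetric])
qed

text \<open>
  With \<open>s = a + b\<close>, the weight depends on \<open>a\<close> and \<open>s\<close> only. The four sums are the expansion of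
  \<open>\<Sum> (1 + [a = 0]) (1 + [s = m]) W\<close> over \<open>a \<le> s \<le> m\<close>.
\<close>
lemma W_sums_eq:
  assumes pos: "\<forall>x\<in>set \<alpha>s. 1 \<le> x" and len: "length \<alpha>s = m + 2"
  shows "(\<Sum>(a, b, c) \<in> {(a, b, c). a + b + c = m}. W \<alpha>s a b c)
           + (\<Sum>(a, b) \<in> {(a, b). a + b = m}. W \<alpha>s a b 0)
           + (\<Sum>(b, c) \<in> {(b, c). b + c = m}. W \<alpha>s 0 b c)
           + W \<alpha>s 0 m 0 = word_weight (rev \<alpha>s)"
proof -
  define q where "q s = (2 :: real) ^ (\<alpha>s ! Suc s - 1) - 1" for s
  have W: "W \<alpha>s a b c = pow_block \<alpha>s a (a + b) * q (a + b)" if "a + b \<le> m" for a b c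
    using W_eq[OF pos, of a b c] that len by (simp add: q_def)
  have "(\<Sum>(a, b, c) \<in> {(a, b, c). a + b + c = m}. W \<alpha>s a b c)
      = (\<Sum>(s, a) \<in> (SIGMA s:{..m}. {..s}). pow_block \<alpha>s a s * q s)"
    by (rule sum.reindex_bij_witness[of _ "\<lambda>(s, a). (a, s - a, m - s)" "\<lambda>(a, b, c). (a + b, a)"])
      (auto simp: W)
  then have 1: "(\<Sum>(a, b, c) \<in> {(a, b, c). a + b + c = m}. W \<alpha>s a b c)
      = (\<Sum>s\<le>m. q s * (\<Sum>a\<le>s. pow_block \<alpha>s a s))"
    by (simp add: sum.Sigma[symmetric] sum_distrib_left mult.commute)
  have "(\<Sum>(a, b) \<in> {(a, b). a + b = m}. W \<alpha>s a b 0) = (\<Sum>a\<le>m. pow_block \<alpha>s a m * q m)"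
    by (rule sum.reindex_bij_witness[of _ "\<lambda>a. (a, m - a)" fst]) (auto simp: W)
  then have 2: "(\<Sum>(a, b) \<in> {(a, b). a + b = m}. W \<alpha>s a b 0) = q m * (\<Sum>a\<le>m. pow_block \<alpha>s a m)"
    by (simp add: sum_distrib_left mult.commute)
  have 3: "(\<Sum>(b, c) \<in> {(b, c). b + c = m}. W \<alpha>s 0 b c) = (\<Sum>s\<le>m. q s * pow_block \<alpha>s 0 s)"
    by (rule sum.reindex_bij_witness[of _ "\<lambda>s. (s, m - s)" fst]) (auto simp: W)
  show ?thesis
    unfolding 1 2 3 word_weight_eq[OF len] prefix_weight_def q_def[symmetric]
    by (simp add: W distrib_left sum.distrib)
qed

lemma all_ones:
  "\<forall>x\<in>set xs. 1 \<le> (x::nat) \<Longrightarrow> sum_list xs \<le> length xs \<Longrightarrow> set xs \<subseteq> {1}"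
proof (induction xs)
  case (Cons x xs)
  then show ?case using length_le_sum_list[of xs] by simp
qed simp

text \<open>
  The distinguished position needs an entry at least 2 and a predecessor. This matches the sum over
  all words with the range \<open>m \<le> p\<close> of the theorem, and makes the coefficients below \<open>u\<^sup>3\<close> vanish.
\<close>
lemma word_weight_nonzero:
  assumes "xs \<in> words q" "word_weight xs \<noteq> 0"
  shows "2 \<le> length xs" "length xs < q"
proof -
  show "2 \<le> length xs"
    using assms(2) by (cases xs; cases "tl xs") auto
  have "tail_weight ys = 0" if "set ys \<subseteq> {1}" for ys
    using that by (induction ys) auto
  then have "word_weight ys = 0" if "set ys \<subseteq> {1}" for ys
    using that by (cases ys) auto
  then show "length xs < q"
    using assms all_ones[of xs] by (force simp: words_def not_less[symmetric])
qed

section \<open>Comparison of coefficients\<close>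

text \<open>
  With \<open>z = u / k\<close>, the series \<open>\<Sum>\<^sub>p (p + 1) (p + 2) / 2 z\<^sup>p = 1 / (1 - z)\<^sup>3\<close> turns the zeta values into
  \<open>\<Sum>\<^sub>k 1 / (k (k - u)\<^sup>3)\<close>.
\<close>
lemma zeta_gf:
  fixes u :: real
  assumes u: "0 < u" "u < 1 / 2"
  shows "(\<lambda>p. ((real p + 1) * (real p + 2) / 2 * mzv [p + 4]) * u ^ p)
     sums (\<Sum>n. 1 / ((real n + 1) * (real n + 1 - u) ^ 3))"
proof -
  let ?f = "\<lambda>n p. (real p + 1) * (real p + 2) / 2 / (real n + 1) ^ (p + 4) * u ^ p"
  let ?g = "\<lambda>n. 1 / ((real n + 1) * (real n + 1 - u) ^ 3)"
  have rows: "?f n sums ?g n" for n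
  proof -
    define x where "x = real n + 1"
    have x: "x > 0" "x - u > 0" "u / x < 1" using u by (simp_all add: x_def)
    have "(\<lambda>p. 1 / x ^ 4 * ((real p + 1) * (real p + 2) / 2 * (u / x) ^ p)) sums
        (1 / x ^ 4 * (1 / (1 - u / x) ^ 3))"
      by (intro sums_mult triangular_gf) (use u x in auto)
    moreover have "1 / x ^ 4 * (1 / (1 - u / x) ^ 3) = 1 / (x * (x - u) ^ 3)"
    proof -
      have "1 - u / x = (x - u) / x" using x by (simp add: field_simps)
      then show ?thesis using x by (simp add: power_divide power3_eq_cube power4_eq_xxxx)
    qed
    ultimately show ?thesis
      by (simp add: x_def power_divide power_add mult_ac)
  qed
  have total: "?g sums (\<Sum>n. ?g n)"
  proof (rule summable_sums[OF summable_comparison_test'[OF summable_inverse_pow[OF u, of 3]]])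
    show "norm (?g n) \<le> 1 / (real n + 1 - u) ^ 3" for n
    proof -
      have "1 * (real n + 1 - u) ^ 3 \<le> (real n + 1) * (real n + 1 - u) ^ 3"
        using u by (intro mult_right_mono) auto
      then show ?thesis
        using u by (auto intro!: divide_left_mono mult_pos_pos)
    qed
  qed simp
  have summ: "summable (\<lambda>n. ?f n p)" for p
    by (rule tonelli_sums(1)[of ?f ?g]) (use rows total u in auto)
  have eq: "(\<Sum>n. ?f n p) = ((real p + 1) * (real p + 2) / 2 * mzv [p + 4]) * u ^ p" for p
  proof -
    define c where "c = (real p + 1) * (real p + 2) / 2 * u ^ p"
    have c: "c \<noteq> 0" using u by (simp add: c_def)
    have f: "?f n p = c * (1 / (real n + 1) ^ (p + 4))" for n
      by (simp add: c_def)
    have s: "summable (\<lambda>n. 1 / (real n + 1) ^ (p + 4))"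
      using summ[of p] c unfolding f by (simp only: summable_cmult_iff) simp
    then have "mzv [p + 4] = (\<Sum>n. 1 / (real n + 1) ^ (p + 4))"
      using mzv_snoc[of "[]" "p + 4"] by simp
    then show ?thesis
      unfolding f suminf_mult[OF s] by (simp add: c_def)
  qed
  have "(\<lambda>p. \<Sum>n. ?f n p) sums (\<Sum>n. ?g n)"
    by (rule tonelli_sums(2)[of ?f ?g]) (use rows total u in auto)
  then show ?thesis
    unfolding eq .
qed

definition weight_term :: "nat list \<Rightarrow> nat \<Rightarrow> real" where
  "weight_term xs n = word_weight xs * (trunc_mzv (tl xs) n / (real n + 1) ^ (hd xs + 1))"

lemma weight_term_nonneg: "0 \<le> weight_term xs n"
  unfolding weight_term_def
  by (intro mult_nonneg_nonneg word_weight_nonneg divide_nonneg_nonneg trunc_mzv_nonneg) simp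

lemma top_slice_word_weight_eq:
  "top_slice word_weight n q / (real n + 1) = (\<Sum>xs\<in>words q - {[]}. weight_term xs n)"
  unfolding top_slice_def weight_term_def sum_divide_distrib by (rule sum.cong) simp_all

text \<open>
  Every slice has a known power series in \<open>u\<close>, and the slices sum to the same value as the zeta
  values; by positivity the slices may be summed coefficientwise.
\<close>
lemma weighted_mzv_gf:
  fixes u :: real
  assumes u: "0 < u" "u < 1 / 2"
  shows "summable (\<lambda>n. top_slice word_weight n (p + 3) / (real n + 1))"
    and "(\<lambda>p. (\<Sum>n. top_slice word_weight n (p + 3) / (real n + 1)) * u ^ p)
      sums (\<Sum>n. 1 / ((real n + 1) * (real n + 1 - u) ^ 3))"
proof -
  let ?f = "\<lambda>n p. top_slice word_weight n (p + 3) / (real n + 1) * u ^ p"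
  have nonneg: "0 \<le> ?f n p" for n p
    using u top_slice_nonneg[of word_weight n "p + 3", OF word_weight_nonneg] by simp
  have rows: "?f n sums slice_gf u n" for n
  proof -
    have "top_slice word_weight n q * u ^ q = 0" if "q < 3" for q
    proof -
      have "word_weight xs = 0" if "xs \<in> words q" for xs
        using word_weight_nonzero[OF that] \<open>q < 3\<close> by force
      then show ?thesis
        by (simp add: top_slice_def)
    qed
    then have "(\<lambda>p. top_slice word_weight n (p + 3) * u ^ (p + 3)) sums (u ^ 3 * (real n + 1) * slice_gf u n)"
      using top_slice_word_weight_sums[OF u, of n] by (subst sums_zero_iff_shift) auto
    from sums_divide[OF this, of "u ^ 3 * (real n + 1)"] show ?thesis
      using u by (simp add: power_add mult_ac)
  qed
  have summ: "summable (\<lambda>n. top_slice word_weight n (p + 3) / (real n + 1))" for p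
  proof -
    have "summable (\<lambda>n. ?f n p / u ^ p)"
      by (intro summable_divide tonelli_sums(1)[of ?f, OF nonneg rows sums_slice_gf[OF u]])
    then show ?thesis using u by simp
  qed
  then show "summable (\<lambda>n. top_slice word_weight n (p + 3) / (real n + 1))" .
  have "(\<Sum>n. ?f n p) = (\<Sum>n. top_slice word_weight n (p + 3) / (real n + 1)) * u ^ p" for p
    by (rule suminf_mult2[symmetric]) (rule summ)
  then show "(\<lambda>p. (\<Sum>n. top_slice word_weight n (p + 3) / (real n + 1)) * u ^ p)
      sums (\<Sum>n. 1 / ((real n + 1) * (real n + 1 - u) ^ 3))"
    using tonelli_sums(2)[of ?f, OF nonneg rows sums_slice_gf[OF u]] by simp
qed

text \<open>
  For a word of positive weight, convergence follows by comparison with the convergent total over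
  all words; a word of weight 0 contributes 0 to both sides whatever its multiple zeta value is.
\<close>
lemma suminf_top_slice_word_weight:
  "(\<Sum>n. top_slice word_weight n (p + 3) / (real n + 1))
     = (\<Sum>xs\<in>words (p + 3) - {[]}. word_weight xs * mzv (rev (tl xs) @ [hd xs + 1]))"
proof -
  have summ: "summable (weight_term xs)" if "xs \<in> words (p + 3) - {[]}" for xs
  proof (rule summable_comparison_test'[OF weighted_mzv_gf(1)[of "1 / 4" p]])
    show "norm (weight_term xs n) \<le> top_slice word_weight n (p + 3) / (real n + 1)" for n
      unfolding top_slice_word_weight_eq using that weight_term_nonneg
      by (auto intro!: member_le_sum finite_Diff finite_words)
  qed simp_all
  have "(\<Sum>n. top_slice word_weight n (p + 3) / (real n + 1))
      = (\<Sum>xs\<in>words (p + 3) - {[]}. \<Sum>n. weight_term xs n)"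
    unfolding top_slice_word_weight_eq by (rule suminf_sum) (rule summ)
  also have "\<dots> = (\<Sum>xs\<in>words (p + 3) - {[]}. word_weight xs * mzv (rev (tl xs) @ [hd xs + 1]))"
  proof (rule sum.cong)
    fix xs assume xs: "xs \<in> words (p + 3) - {[]}"
    show "(\<Sum>n. weight_term xs n) = word_weight xs * mzv (rev (tl xs) @ [hd xs + 1])"
    proof (cases "word_weight xs = 0")
      case False
      have "summable (\<lambda>n. weight_term xs n / word_weight xs)"
        by (rule summable_divide[OF summ[OF xs]])
      then have s: "summable (\<lambda>n. trunc_mzv (tl xs) n / (real n + 1) ^ (hd xs + 1))"
        using False by (simp add: weight_term_def)
      show ?thesis
        unfolding weight_term_def suminf_mult[OF s] mzv_snoc[OF s] ..
    qed (simp add: weight_term_def)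
  qed simp
  finally show ?thesis .
qed

lemma sum_words_by_length:
  "(\<Sum>xs\<in>words (p + 3) - {[]}. word_weight xs * F xs)
     = (\<Sum>m\<le>p. \<Sum>\<alpha>s\<in>compositions (m + 2) (p + 3). word_weight (rev \<alpha>s) * F (rev \<alpha>s))"
proof -
  define S where "S = {xs \<in> words (p + 3). 2 \<le> length xs \<and> length xs < p + 3}"
  have "(\<Sum>xs\<in>words (p + 3) - {[]}. word_weight xs * F xs) = (\<Sum>xs\<in>S. word_weight xs * F xs)"
    by (rule sum.mono_neutral_right)
      (use word_weight_nonzero in \<open>auto simp: S_def finite_words\<close>)
  also have "\<dots> = (\<Sum>m\<le>p. \<Sum>xs\<in>{xs \<in> S. length xs - 2 = m}. word_weight xs * F xs)"
    by (rule sum.group[symmetric]) (auto simp: S_def finite_words)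
  also have "\<dots> = (\<Sum>m\<le>p. \<Sum>\<alpha>s\<in>compositions (m + 2) (p + 3). word_weight (rev \<alpha>s) * F (rev \<alpha>s))"
  proof (rule sum.cong)
    fix m assume "m \<in> {..p}"
    then show "(\<Sum>xs\<in>{xs \<in> S. length xs - 2 = m}. word_weight xs * F xs)
        = (\<Sum>\<alpha>s\<in>compositions (m + 2) (p + 3). word_weight (rev \<alpha>s) * F (rev \<alpha>s))"
      by (intro sum.reindex_bij_witness[of _ rev rev])
        (auto simp: S_def words_def compositions_def)
  qed simp
  finally show ?thesis .
qed

theorem mainTheorem1:
  fixes p :: nat
  shows "(real p + 1) * (real p + 2) / 2 * mzv [p + 4] =
    (\<Sum>(m, n) \<in> {(m :: nat, n :: nat). m + n = p}.
      \<Sum>\<alpha>s \<in> compositions (m + 2) (p + 3).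
        mzv (\<alpha>s[m + 1 := \<alpha>s ! (m + 1) + 1]) *
          ((\<Sum>(a, b, c) \<in> {(a, b, c). a + b + c = m}. W \<alpha>s a b c)
           + (\<Sum>(a, b) \<in> {(a, b). a + b = m}. W \<alpha>s a b 0)
           + (\<Sum>(b, c) \<in> {(b, c). b + c = m}. W \<alpha>s 0 b c)
           + W \<alpha>s 0 m 0))"
proof -
  define F where "F xs = mzv (rev (tl xs) @ [hd xs + 1])" for xs
  have "(\<lambda>p. (real p + 1) * (real p + 2) / 2 * mzv [p + 4])
      = (\<lambda>p. \<Sum>n. top_slice word_weight n (p + 3) / (real n + 1))"
    by (rule powser_unique_right[of "1 / 2"]) (simp, erule (1) zeta_gf, erule (1) weighted_mzv_gf(2))
  then have "(real p + 1) * (real p + 2) / 2 * mzv [p + 4]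
      = (\<Sum>n. top_slice word_weight n (p + 3) / (real n + 1))"
    by (rule fun_cong)
  also have "\<dots> = (\<Sum>m\<le>p. \<Sum>\<alpha>s\<in>compositions (m + 2) (p + 3). word_weight (rev \<alpha>s) * F (rev \<alpha>s))"
    unfolding suminf_top_slice_word_weight F_def by (rule sum_words_by_length)
  also have "\<dots> = (\<Sum>m\<le>p. \<Sum>\<alpha>s \<in> compositions (m + 2) (p + 3).
        mzv (\<alpha>s[m + 1 := \<alpha>s ! (m + 1) + 1]) *
          ((\<Sum>(a, b, c) \<in> {(a, b, c). a + b + c = m}. W \<alpha>s a b c)
           + (\<Sum>(a, b) \<in> {(a, b). a + b = m}. W \<alpha>s a b 0)
           + (\<Sum>(b, c) \<in> {(b, c). b + c = m}. W \<alpha>s 0 b c)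
           + W \<alpha>s 0 m 0))"
  proof (intro sum.cong refl)
    fix m \<alpha>s assume "\<alpha>s \<in> compositions (m + 2) (p + 3)"
    then have len: "length \<alpha>s = m + 2" and pos: "\<forall>x\<in>set \<alpha>s. 1 \<le> x"
      by (auto simp: compositions_def)
    from len obtain \<beta>s x where \<alpha>s: "\<alpha>s = \<beta>s @ [x]" and "length \<beta>s = m + 1"
      by (cases \<alpha>s rule: rev_cases) auto
    then have "F (rev \<alpha>s) = mzv (\<alpha>s[m + 1 := \<alpha>s ! (m + 1) + 1])"
      by (simp add: F_def list_update_append nth_append)
    then show "word_weight (rev \<alpha>s) * F (rev \<alpha>s) = mzv (\<alpha>s[m + 1 := \<alpha>s ! (m + 1) + 1]) *
          ((\<Sum>(a, b, c) \<in> {(a, b, c). a + b + c = m}. W \<alpha>s a b c)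
           + (\<Sum>(a, b) \<in> {(a, b). a + b = m}. W \<alpha>s a b 0)
           + (\<Sum>(b, c) \<in> {(b, c). b + c = m}. W \<alpha>s 0 b c)
           + W \<alpha>s 0 m 0)"
      unfolding W_sums_eq[OF pos len] by (simp only: mult.commute)
  qed
  also have "\<dots> = (\<Sum>(m, n) \<in> {(m :: nat, n :: nat). m + n = p}.
      \<Sum>\<alpha>s \<in> compositions (m + 2) (p + 3).
        mzv (\<alpha>s[m + 1 := \<alpha>s ! (m + 1) + 1]) *
          ((\<Sum>(a, b, c) \<in> {(a, b, c). a + b + c = m}. W \<alpha>s a b c)
           + (\<Sum>(a, b) \<in> {(a, b). a + b = m}. W \<alpha>s a b 0)
           + (\<Sum>(b, c) \<in> {(b, c). b + c = m}. W \<alpha>s 0 b c)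
           + W \<alpha>s 0 m 0))"
    by (rule sum.reindex_bij_witness[of _ fst "\<lambda>m. (m, p - m)"]) auto
  finally show ?thesis .
qed

end
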